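(* Let $\Sigma$ be a convex entire spacelike surface in $\mathbb R^{2,1}$ with null support function $\phi$. If $\gamma:[0,T)\to\Sigma$ is a proper geodesic with finite length, then: 1. There is a unique direction $\theta_+\in\mathbb S^1$ such that $\dot\gamma(t)$ converges projectively to $\vec\theta_+$ as $t\to T$. 2. There is a unique null line $L=\{x+r\vec\theta_+ : r\in\mathbb R\}$ in $\mathbb R^{2,1}$ such that $\gamma$ is asymptotic to $L$. 3. $\langle\gamma(t),\vec\theta_+\rangle\to\phi(\theta_+)<\infty$ as $t\to T$. 4. $\langle\gamma(t),\vec\theta\rangle\to-\infty$ as $t\to T$ for all $\theta\in\mathbb S^1$ with $\theta\ne\theta_+$.
   Context: $\mathbb R^{2,1}$ is $\mathbb R^3$ with the Lorentzian product $\langle(x,y,z),(x',y',z')\rangle=xx'+yy'-zz'$. A convex entire spacelike surface $\Sigma$ is the graph of a convex function $f:\mathbb R^2\to\mathbb R$ with $\|Df\|<1$ everywhere; surfaces are assumed to be of class $C^2$. Geodesics and lengths are with respect to the induced Riemannian metric; a geodesic $\gamma:[0,T)\to\Sigma$ is proper if it is a proper map into $\Sigma$ (it eventually leaves every compact subset). $\mathbb S^1=\mathbb R/2\pi\mathbb Z$ and $\vec\theta=(\cos\theta,\sin\theta,1)$. The null support function of $\Sigma$ is $\phi(\theta)=\sup_{p\in\Sigma}\langle p,\vec\theta\rangle\in\mathbb R\cup\{+\infty\}$. A curve is asymptotic to an affine subspace $V$ (with parallel linear subspace $TV$) if it converges in the quotient $\mathbb R^{2,1}/TV$ to the point corresponding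 to $V$. *)

theory Defs
  imports "HOL-Analysis.Analysis"
begin

definition lorentz :: "real^3 \<Rightarrow> real^3 \<Rightarrow> real" where
  "lorentz p q = p$1 * q$1 + p$2 * q$2 - p$3 * q$3"

definition null_vec :: "real \<Rightarrow> real^3" where
  "null_vec \<theta> = vector [cos \<theta>, sin \<theta>, 1]"

(* Representatives of the points of R / 2 pi Z. *)
definition circle :: "real set" where
  "circle = {0..<2 * pi}"

definition C2 :: "('a::euclidean_space \<Rightarrow> real) \<Rightarrow> bool" where
  "C2 f \<longleftrightarrow>
    (\<exists>(f' :: 'a \<Rightarrow> 'a \<Rightarrow>\<^sub>L real) (f'' :: 'a \<Rightarrow> 'a \<Rightarrow>\<^sub>L ('a \<Rightarrow>\<^sub>L real)).
      (\<forall>x. (f has_derivative blinfun_apply (f' x)) (at x)) \<and>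
      (\<forall>x. (f' has_derivative blinfun_apply (f'' x)) (at x)) \<and>
      continuous_on UNIV f'')"

definition convex_entire_spacelike :: "(real^2 \<Rightarrow> real) \<Rightarrow> bool" where
  "convex_entire_spacelike f \<longleftrightarrow>
    C2 f \<and> convex_on UNIV f \<and> (\<forall>x. onorm (frechet_derivative f (at x)) < 1)"

definition graph_map :: "(real^2 \<Rightarrow> real) \<Rightarrow> real^2 \<Rightarrow> real^3" where
  "graph_map f x = vector [x$1, x$2, f x]"

definition surface :: "(real^2 \<Rightarrow> real) \<Rightarrow> (real^3) set" where
  "surface f = range (graph_map f)"

definition null_support :: "(real^3) set \<Rightarrow> real \<Rightarrow> ereal" where
  "null_support \<Sigma> \<theta> = (SUP p\<in>\<Sigma>. ereal (lorentz p (null_vec \<theta>)))"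

definition partial :: "'n \<Rightarrow> (real^'n \<Rightarrow> 'b) \<Rightarrow> real^'n \<Rightarrow> 'b::real_normed_vector" where
  "partial i h x = frechet_derivative h (at x) (axis i 1)"

definition induced_metric :: "(real^2 \<Rightarrow> real) \<Rightarrow> real^2 \<Rightarrow> real^2^2" where
  "induced_metric f x =
    (\<chi> i j. lorentz (partial i (graph_map f) x) (partial j (graph_map f) x))"

(* christoffel G x k i j is the Christoffel symbol of the second kind with upper index k
   of the metric G. *)
definition christoffel :: "(real^'n \<Rightarrow> real^'n^'n) \<Rightarrow> real^'n \<Rightarrow> 'n \<Rightarrow> 'n \<Rightarrow> 'n \<Rightarrow> real" where
  "christoffel G x k i j =
    (\<Sum>l\<in>UNIV. matrix_inv (G x) $ k $ l *
      (partial i (\<lambda>y. G y $ j $ l) x + partial j (\<lambda>y. G y $ i $ l) x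
        - partial l (\<lambda>y. G y $ i $ j) x) / 2)"

definition metric_geodesic_on ::
  "(real^'n \<Rightarrow> real^'n^'n) \<Rightarrow> real set \<Rightarrow> (real \<Rightarrow> real^'n) \<Rightarrow> bool" where
  "metric_geodesic_on G I u \<longleftrightarrow>
    (\<exists>u' u''. \<forall>t\<in>I.
      (u has_vector_derivative u' t) (at t within I) \<and>
      (u' has_vector_derivative u'' t) (at t within I) \<and>
      (\<forall>k. u'' t $ k
        + (\<Sum>i\<in>UNIV. \<Sum>j\<in>UNIV. christoffel G (u t) k i j * u' t $ i * u' t $ j) = 0))"

definition geodesic_on :: "(real^2 \<Rightarrow> real) \<Rightarrow> real set \<Rightarrow> (real \<Rightarrow> real^3) \<Rightarrow> bool" where
  "geodesic_on f I \<gamma> \<longleftrightarrow>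
    (\<exists>u. (\<forall>t\<in>I. \<gamma> t = graph_map f (u t)) \<and> metric_geodesic_on (induced_metric f) I u)"

definition velocity :: "real set \<Rightarrow> (real \<Rightarrow> real^3) \<Rightarrow> real \<Rightarrow> real^3" where
  "velocity I \<gamma> t = vector_derivative \<gamma> (at t within I)"

(* On a spacelike surface the induced norm of a tangent vector v is sqrt (lorentz v v). *)
definition curve_length :: "real set \<Rightarrow> (real \<Rightarrow> real^3) \<Rightarrow> ennreal" where
  "curve_length I \<gamma> =
    (\<integral>\<^sup>+t\<in>I. ennreal (sqrt (lorentz (velocity I \<gamma> t) (velocity I \<gamma> t))) \<partial>lborel)"

(* The interval [0,T) and the filter t -> T; the endpoint T may be infinite. *)
definition halfopen :: "ereal \<Rightarrow> real set" where
  "halfopen T = {t. 0 \<le> t \<and> ereal t < T}"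

definition to_end :: "ereal \<Rightarrow> real filter" where
  "to_end T = filtercomap ereal (at_left T)"

definition quotient_topology :: "'a topology \<Rightarrow> ('a \<Rightarrow> 'b) \<Rightarrow> 'b topology" where
  "quotient_topology X q =
    topology (\<lambda>U. U \<subseteq> q ` topspace X \<and> openin X {x \<in> topspace X. q x \<in> U})"

lemma openin_quotient_topology:
  "openin (quotient_topology X q) U \<longleftrightarrow>
    U \<subseteq> q ` topspace X \<and> openin X {x \<in> topspace X. q x \<in> U}"
proof -
  let ?P = "\<lambda>U. U \<subseteq> q ` topspace X \<and> openin X {x \<in> topspace X. q x \<in> U}"
  have "istopology (\<lambda>U. U \<subseteq> q ` topspace X \<and> openin X {x \<in> topspace X. q x \<in> U})"
    unfolding istopology_def
  proof (rule conjI)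
    show "\<forall>S T. ?P S \<longrightarrow> ?P T \<longrightarrow> ?P (S \<inter> T)"
    proof (intro allI impI)
      fix S T
      assume "?P S" "?P T"
      moreover have "{x \<in> topspace X. q x \<in> S \<inter> T} =
          {x \<in> topspace X. q x \<in> S} \<inter> {x \<in> topspace X. q x \<in> T}"
        by blast
      ultimately show "?P (S \<inter> T)"
        by auto
    qed
    show "\<forall>\<K>. (\<forall>K\<in>\<K>. ?P K) \<longrightarrow> ?P (\<Union>\<K>)"
    proof (intro allI impI)
      fix \<K>
      assume "\<forall>K\<in>\<K>. ?P K"
      moreover have "{x \<in> topspace X. q x \<in> \<Union>\<K>} =
          (\<Union>K\<in>\<K>. {x \<in> topspace X. q x \<in> K})"
        by blast
      ultimately show "?P (\<Union>\<K>)"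
        by auto
    qed
  qed
  then show ?thesis
    by (simp add: quotient_topology_def)
qed

lemma topspace_quotient_topology: "topspace (quotient_topology X q) = q ` topspace X"
proof (rule subset_antisym)
  show "topspace (quotient_topology X q) \<subseteq> q ` topspace X"
    using openin_topspace openin_quotient_topology by metis
  have "{x \<in> topspace X. q x \<in> q ` topspace X} = topspace X"
    by blast
  then have "openin (quotient_topology X q) (q ` topspace X)"
    by (simp add: openin_quotient_topology)
  then show "q ` topspace X \<subseteq> topspace (quotient_topology X q)"
    by (rule openin_subset)
qed

lemma quotient_map_quotient_topology: "quotient_map X (quotient_topology X q) q"
  unfolding quotient_map_def by (simp add: topspace_quotient_topology openin_quotient_topology)

(* Points of projective space are the lines span {v} through the origin. *)
definition converges_projectively ::
  "(real \<Rightarrow> 'v::euclidean_space) \<Rightarrow> 'v \<Rightarrow> real filter \<Rightarrow> bool" where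
  "converges_projectively v w F \<longleftrightarrow>
    limitin (quotient_topology (top_of_set (- {0})) (\<lambda>x. span {x}))
      (\<lambda>t. span {v t}) (span {w}) F"

definition direction_space :: "'v::euclidean_space set \<Rightarrow> 'v set" where
  "direction_space V = {x - y |x y. x \<in> V \<and> y \<in> V}"

(* Points of the quotient by W = direction_space V are the cosets x + W; V itself is one of them. *)
definition asymptotic_to ::
  "(real \<Rightarrow> 'v::euclidean_space) \<Rightarrow> 'v set \<Rightarrow> real filter \<Rightarrow> bool" where
  "asymptotic_to \<gamma> V F \<longleftrightarrow> V \<noteq> {} \<and> affine V \<and>
    limitin (quotient_topology euclidean (\<lambda>x. (\<lambda>w. x + w) ` direction_space V))
      (\<lambda>t. (\<lambda>w. \<gamma> t + w) ` direction_space V) V F"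

end

theory Submission
  imports Defs
begin

text \<open>
  The acceleration of a geodesic is \<open>\<mu> (Df, 1)\<close> with \<open>\<mu> \<ge> 0\<close> by convexity, a future timelike vector.
  Write the velocity as \<open>(u', z')\<close>. Then \<open>z'\<close> and, for each unit vector \<open>e\<close>, \<open>z' - \<langle>u', e\<rangle>\<close> are
  nondecreasing, and \<open>|u'|\<^sup>2 - z'\<^sup>2 = \<kappa>\<close> is constant. Finite length forces finite time, and then
  properness forces \<open>z' \<rightarrow> \<infinity>\<close>, since otherwise the curve would converge. The sets
  \<open>{e. z' \<le> \<langle>u', e\<rangle>}\<close> of unit vectors decrease in time, so they share a vector \<open>e\<close>; expanding the
  square gives \<open>|u' - z' e|\<^sup>2 = \<kappa> + 2 z' (z' - \<langle>u', e\<rangle>) \<le> \<kappa>\<close>. Hence \<open>u'/z' \<rightarrow> e\<close>, and in finite time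
  \<open>u - z e\<close> converges to some \<open>y\<close>, which is the null asymptote. Finally \<open>\<langle>y, e\<rangle>\<close> is the null
  support value because \<open>f\<close> is 1-Lipschitz: \<open>z \<le> f v + |u - v|\<close>, where \<open>|u - v| = z + \<langle>y - v, e\<rangle> + o(1)\<close>.
\<close>

section \<open>Second derivatives\<close>

text \<open>The case \<open>k = - h\<close> turns midpoint convexity into a sign of the Hessian.\<close>

lemma second_difference_quotient_tendsto:
  fixes f :: "'a::real_normed_vector \<Rightarrow> real" and f' :: "'a \<Rightarrow> 'a \<Rightarrow>\<^sub>L real"
    and H :: "'a \<Rightarrow>\<^sub>L 'a \<Rightarrow>\<^sub>L real"
  assumes df: "\<And>y. (f has_derivative blinfun_apply (f' y)) (at y)"
    and d2f: "(f' has_derivative blinfun_apply H) (at x)"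
  shows "((\<lambda>s. (f (x + s *\<^sub>R h + s *\<^sub>R k) - f (x + s *\<^sub>R h) - f (x + s *\<^sub>R k) + f x) / s\<^sup>2)
           \<longlongrightarrow> H k h) (at_right 0)"
proof (rule tendstoI)
  fix \<epsilon> :: real
  assume "0 < \<epsilon>"
  \<comment> \<open>After division by \<open>s\<close> the error carries the factor
    \<open>(2 * norm h + norm k) * norm h\<close>, which \<open>K\<close> majorizes; the summands 1
    keep \<open>K\<close> positive.\<close>
  define K where "K = (2 * norm h + norm k + 1) * (norm h + 1)"
  have "0 < K"
    unfolding K_def by (intro mult_pos_pos) (auto intro: add_nonneg_pos)
  define e where "e = \<epsilon> / (2 * K)"
  have "0 < e" using \<open>0 < \<epsilon>\<close> \<open>0 < K\<close> by (simp add: e_def)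
  obtain d where "0 < d" and
    d: "\<And>y. norm (y - x) < d \<Longrightarrow> norm (f' y - f' x - H (y - x)) \<le> e * norm (y - x)"
    using d2f \<open>0 < e\<close> unfolding has_derivative_at_alt by meson
  \<comment> \<open>\<open>s * L < d\<close> keeps both \<open>r *\<^sub>R h + s *\<^sub>R k\<close>
    and \<open>r *\<^sub>R h\<close> in the ball of radius \<open>d\<close> whenever
    \<open>r\<close> lies between 0 and \<open>s\<close>.\<close>
  define L where "L = norm h + norm k + 1"
  have "0 < L" by (simp add: L_def add_nonneg_pos)
  have close: "dist ((f (x + s *\<^sub>R h + s *\<^sub>R k) - f (x + s *\<^sub>R h) - f (x + s *\<^sub>R k) + f x) / s\<^sup>2)
      (H k h) < \<epsilon>" if s: "0 < s" "s < d / L" for s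
  proof -
    \<comment> \<open>The mean value theorem is applied in direction \<open>h\<close> only; the
      remaining difference of \<open>f'\<close> is compared with \<open>H\<close> by
      differentiability at the single point \<open>x\<close>.\<close>
    let ?g = "\<lambda>r. f (x + r *\<^sub>R h + s *\<^sub>R k) - f (x + r *\<^sub>R h)"
    have "\<exists>r\<in>{0<..<s}. ?g s - ?g 0 =
        (\<lambda>\<delta>. \<delta> * (f' (x + r *\<^sub>R h + s *\<^sub>R k) h - f' (x + r *\<^sub>R h) h)) (s - 0)"
      using \<open>0 < s\<close>
      by (rule mvt_simple)
         (auto intro!: derivative_eq_intros has_derivative_compose[OF _ df]
           simp: blinfun.scaleR_right algebra_simps)
    then obtain r where r: "0 < r" "r < s" and
      g: "?g s - ?g 0 = s * (f' (x + r *\<^sub>R h + s *\<^sub>R k) h - f' (x + r *\<^sub>R h) h)"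
      by auto
    have sL: "s * L < d" using s \<open>0 < L\<close> by (simp add: field_simps)
    have n1: "norm (r *\<^sub>R h + s *\<^sub>R k) \<le> s * (norm h + norm k)"
    proof -
      have "norm (r *\<^sub>R h + s *\<^sub>R k) \<le> r * norm h + s * norm k"
        using norm_triangle_ineq[of "r *\<^sub>R h" "s *\<^sub>R k"] r s by simp
      also have "\<dots> \<le> s * norm h + s * norm k"
        using r by (intro add_right_mono mult_right_mono) auto
      finally show ?thesis by (simp add: algebra_simps)
    qed
    have n2: "norm (r *\<^sub>R h) \<le> s * norm h"
      using r by (simp add: mult_right_mono)
    have "s * (norm h + norm k) \<le> s * L" "s * norm h \<le> s * L"
      unfolding L_def using s by (intro mult_left_mono; simp)+
    then have d1: "norm (f' (x + (r *\<^sub>R h + s *\<^sub>R k)) - f' x - H (r *\<^sub>R h + s *\<^sub>R k))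
          \<le> e * norm (r *\<^sub>R h + s *\<^sub>R k)"
      and d2: "norm (f' (x + r *\<^sub>R h) - f' x - H (r *\<^sub>R h)) \<le> e * norm (r *\<^sub>R h)"
      using d[of "x + (r *\<^sub>R h + s *\<^sub>R k)"] d[of "x + r *\<^sub>R h"] n1 n2 sL by auto
    have "norm (f' (x + r *\<^sub>R h + s *\<^sub>R k) - f' (x + r *\<^sub>R h) - s *\<^sub>R H k)
        \<le> e * norm (r *\<^sub>R h + s *\<^sub>R k) + e * norm (r *\<^sub>R h)"
    proof -
      \<comment> \<open>The unknown \<open>r\<close> drops out, since
        \<open>H (r *\<^sub>R h + s *\<^sub>R k) - H (r *\<^sub>R h)\<close> is
        \<open>s *\<^sub>R H k\<close>.\<close>
      have "f' (x + r *\<^sub>R h + s *\<^sub>R k) - f' (x + r *\<^sub>R h) - s *\<^sub>R H k =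
         (f' (x + (r *\<^sub>R h + s *\<^sub>R k)) - f' x - H (r *\<^sub>R h + s *\<^sub>R k))
          - (f' (x + r *\<^sub>R h) - f' x - H (r *\<^sub>R h))"
        by (simp add: blinfun.add_right blinfun.scaleR_right algebra_simps)
      then show ?thesis
        using norm_triangle_ineq4 d1 d2 by (smt (verit))
    qed
    also have "\<dots> \<le> e * (s * (2 * norm h + norm k))"
    proof -
      have "norm (r *\<^sub>R h + s *\<^sub>R k) + norm (r *\<^sub>R h) \<le> s * (2 * norm h + norm k)"
        using n1 n2 by (simp add: algebra_simps)
      then show ?thesis
        using \<open>0 < e\<close> by (metis distrib_left less_imp_le mult_left_mono)
    qed
    finally have B: "norm (f' (x + r *\<^sub>R h + s *\<^sub>R k) - f' (x + r *\<^sub>R h) - s *\<^sub>R H k)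
        \<le> e * (s * (2 * norm h + norm k))" .
    have "\<bar>f' (x + r *\<^sub>R h + s *\<^sub>R k) h - f' (x + r *\<^sub>R h) h - s * H k h\<bar>
        \<le> e * (s * (2 * norm h + norm k)) * norm h"
    proof -
      have "f' (x + r *\<^sub>R h + s *\<^sub>R k) h - f' (x + r *\<^sub>R h) h - s * H k h
         = (f' (x + r *\<^sub>R h + s *\<^sub>R k) - f' (x + r *\<^sub>R h) - s *\<^sub>R H k) h"
        by (simp add: blinfun.diff_left blinfun.scaleR_left)
      then show ?thesis
        using norm_blinfun[of "f' (x + r *\<^sub>R h + s *\<^sub>R k) - f' (x + r *\<^sub>R h) - s *\<^sub>R H k" h]
          mult_right_mono[OF B norm_ge_zero[of h]] by auto
    qed
    also have "\<dots> \<le> e * s * K"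
      unfolding K_def using \<open>0 < e\<close> s
      by (simp add: mult.assoc) (intro mult_left_mono mult_mono; simp)
    finally have C: "\<bar>f' (x + r *\<^sub>R h + s *\<^sub>R k) h - f' (x + r *\<^sub>R h) h - s * H k h\<bar> \<le> e * s * K" .
    have "f (x + s *\<^sub>R h + s *\<^sub>R k) - f (x + s *\<^sub>R h) - f (x + s *\<^sub>R k) + f x
        = s * (f' (x + r *\<^sub>R h + s *\<^sub>R k) h - f' (x + r *\<^sub>R h) h)"
      using g by simp
    then have "(f (x + s *\<^sub>R h + s *\<^sub>R k) - f (x + s *\<^sub>R h) - f (x + s *\<^sub>R k) + f x) / s\<^sup>2 - H k h
        = (f' (x + r *\<^sub>R h + s *\<^sub>R k) h - f' (x + r *\<^sub>R h) h - s * H k h) / s"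
      using s by (simp only:) (simp add: field_simps power2_eq_square)
    then have "dist ((f (x + s *\<^sub>R h + s *\<^sub>R k) - f (x + s *\<^sub>R h) - f (x + s *\<^sub>R k) + f x) / s\<^sup>2) (H k h)
        \<le> e * K"
      using C s by (simp add: dist_real_def abs_divide divide_le_eq mult_ac)
    also have "\<dots> < \<epsilon>" using \<open>0 < \<epsilon>\<close> \<open>0 < K\<close> by (simp add: e_def)
    finally show ?thesis .
  qed
  show "\<forall>\<^sub>F s in at_right 0. dist ((f (x + s *\<^sub>R h + s *\<^sub>R k) - f (x + s *\<^sub>R h)
      - f (x + s *\<^sub>R k) + f x) / s\<^sup>2) (H k h) < \<epsilon>"
    using eventually_at_right_real[of 0 "d / L"] close \<open>0 < d\<close> \<open>0 < L\<close>
    by (auto elim!: eventually_mono)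
qed

text \<open>The second difference is symmetric in its two increments, so both sides are limits of
  the same quotient.\<close>

lemma second_derivative_symmetric:
  fixes f :: "'a::real_normed_vector \<Rightarrow> real" and f' :: "'a \<Rightarrow> 'a \<Rightarrow>\<^sub>L real"
    and H :: "'a \<Rightarrow>\<^sub>L 'a \<Rightarrow>\<^sub>L real"
  assumes "\<And>y. (f has_derivative blinfun_apply (f' y)) (at y)"
    and "(f' has_derivative blinfun_apply H) (at x)"
  shows "H k h = H h k"
proof (rule tendsto_unique[OF _ second_difference_quotient_tendsto[OF assms, of h k]])
  show "((\<lambda>s. (f (x + s *\<^sub>R h + s *\<^sub>R k) - f (x + s *\<^sub>R h) - f (x + s *\<^sub>R k) + f x) / s\<^sup>2)
           \<longlongrightarrow> H h k) (at_right 0)"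
    using second_difference_quotient_tendsto[OF assms, of k h]
    by (simp add: add_ac diff_diff_eq)
qed simp

lemma convex_on_imp_second_derivative_nonneg:
  fixes f :: "'a::real_normed_vector \<Rightarrow> real" and f' :: "'a \<Rightarrow> 'a \<Rightarrow>\<^sub>L real"
    and H :: "'a \<Rightarrow>\<^sub>L 'a \<Rightarrow>\<^sub>L real"
  assumes "\<And>y. (f has_derivative blinfun_apply (f' y)) (at y)"
    and "(f' has_derivative blinfun_apply H) (at x)"
    and f: "convex_on UNIV f"
  shows "0 \<le> H h h"
proof -
  have "2 * f x \<le> f (x + s *\<^sub>R h) + f (x - s *\<^sub>R h)" for s
    using convex_onD[OF f, of "1/2" "x + s *\<^sub>R h" "x - s *\<^sub>R h"]
    by (simp add: algebra_simps flip: scaleR_2)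
  \<comment> \<open>For opposite increments the doubly shifted point is \<open>x\<close> itself, so
    the numerator contains \<open>f x\<close> twice.\<close>
  then have "(f (x + s *\<^sub>R h + s *\<^sub>R - h) - f (x + s *\<^sub>R h) - f (x + s *\<^sub>R - h) + f x) / s\<^sup>2 \<le> 0" for s
    by (intro divide_nonpos_nonneg) (auto simp: algebra_simps)
  then have "H (- h) h \<le> 0"
    by (intro tendsto_upperbound[OF second_difference_quotient_tendsto[OF assms(1,2)]]) auto
  then show ?thesis
    by (simp add: blinfun.minus_right blinfun.minus_left)
qed

section \<open>Curves with monotone causal acceleration\<close>

lemma nonneg_vector_derivative_imp_mono:
  fixes g :: "real \<Rightarrow> real"
  assumes I: "is_interval I"
    and g: "\<And>t. t \<in> I \<Longrightarrow> (g has_vector_derivative g' t) (at t within I)"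
    and nonneg: "\<And>t. t \<in> I \<Longrightarrow> 0 \<le> g' t"
    and st: "s \<in> I" "t \<in> I" "s \<le> t"
  shows "g s \<le> g t"
proof -
  have sub: "{s..t} \<subseteq> I"
    using mem_is_interval_1_I[OF I st(1,2)] by auto
  have "(g has_derivative (\<lambda>h. h * g' r)) (at r within {s..t})" if "s \<le> r" "r \<le> t" for r
    using has_vector_derivative_within_subset[OF g sub, of r] that sub
    by (auto simp: has_vector_derivative_def)
  from mvt_very_simple[OF \<open>s \<le> t\<close> this] obtain r where
    "r \<in> {s..t}" "g t - g s = (t - s) * g' r" by auto
  moreover from this have "0 \<le> (t - s) * g' r"
    using nonneg[of r] sub st by (intro mult_nonneg_nonneg) auto
  ultimately show ?thesis by simp
qed

text \<open>A nondecreasing function tends to its supremum, so only boundedness is in question. The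
  bound by \<open>l\<close> later controls \<open>z'\<close> on the whole interval.\<close>

lemma monotone_at_left_cases:
  fixes g :: "real \<Rightarrow> real"
  assumes "a < b" and mono: "\<And>s t. a \<le> s \<Longrightarrow> s \<le> t \<Longrightarrow> t < b \<Longrightarrow> g s \<le> g t"
  shows "filterlim g at_top (at_left b) \<or> (\<exists>l. (g \<longlongrightarrow> l) (at_left b) \<and> (\<forall>t\<in>{a..<b}. g t \<le> l))"
proof (cases "bdd_above (g ` {a..<b})")
  case True
  define l where "l = (SUP t\<in>{a..<b}. g t)"
  have le: "g t \<le> l" if "t \<in> {a..<b}" for t
    unfolding l_def using that True by (rule cSUP_upper)
  have "(g \<longlongrightarrow> l) (at_left b)"
  proof (rule order_tendstoI)
    fix c assume "c < l"
    then obtain s where s: "s \<in> {a..<b}" "c < g s"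
      unfolding l_def using less_cSUP_iff[OF _ True] \<open>a < b\<close> by auto
    then have "s < b" by simp
    then show "\<forall>\<^sub>F t in at_left b. c < g t"
    proof (rule eventually_mono[OF eventually_at_left_real])
      fix t assume "t \<in> {s<..<b}"
      then have "g s \<le> g t" using s mono[of s t] by auto
      then show "c < g t" using s by simp
    qed
  next
    fix c assume "l < c"
    then show "\<forall>\<^sub>F t in at_left b. g t < c"
      by (intro eventually_mono[OF eventually_at_left_real[OF \<open>a < b\<close>]]) (auto intro: le_less_trans[OF le])
  qed
  then show ?thesis using le by blast
next
  case False
  have "filterlim g at_top (at_left b)"
    unfolding filterlim_at_top
  proof
    fix c
    obtain s where s: "s \<in> {a..<b}" "c < g s"
      using False unfolding bdd_above_def by (force simp: not_le)
    then have "s < b" by simp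
    then show "\<forall>\<^sub>F t in at_left b. c \<le> g t"
    proof (rule eventually_mono[OF eventually_at_left_real])
      fix t assume "t \<in> {s<..<b}"
      then have "g s \<le> g t" using s mono[of s t] by auto
      then show "c \<le> g t" using s by simp
    qed
  qed
  then show ?thesis ..
qed

text \<open>A bounded derivative makes the curve Lipschitz, hence uniformly continuous, and
  completeness extends it to \<open>b\<close>. This is where finite time enters.\<close>

lemma bounded_velocity_imp_convergent_at_left:
  fixes g :: "real \<Rightarrow> 'a::banach"
  assumes "a < b"
    and g: "\<And>t. t \<in> {a..<b} \<Longrightarrow> (g has_vector_derivative g' t) (at t within {a..<b})"
    and B: "\<And>t. t \<in> {a..<b} \<Longrightarrow> norm (g' t) \<le> B"
  obtains l where "(g \<longlongrightarrow> l) (at_left b)"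
proof -
  have "0 \<le> B" using order_trans[OF norm_ge_zero B[of a]] \<open>a < b\<close> by simp
  have "norm (g s - g t) \<le> B * norm (s - t)" if "s \<in> {a..<b}" "t \<in> {a..<b}" for s t
  proof (rule differentiable_bound[OF _ _ _ that])
    show "convex {a..<b}" by (rule convex_real_interval)
  next
    fix t assume "t \<in> {a..<b}"
    then show "(g has_derivative (\<lambda>h. h *\<^sub>R g' t)) (at t within {a..<b})"
      using g by (simp add: has_vector_derivative_def)
  next
    fix t assume "t \<in> {a..<b}"
    then show "onorm (\<lambda>h. h *\<^sub>R g' t) \<le> B"
      using B \<open>0 \<le> B\<close> by (intro onorm_bound) (auto simp: mult.commute[of B] mult_left_mono)
  qed
  then have "B-lipschitz_on {a..<b} g"
    using \<open>0 \<le> B\<close> by (auto simp: lipschitz_on_def dist_norm)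
  then have "uniformly_continuous_on {a..<b} g"
    by (rule lipschitz_on_uniformly_continuous)
  then obtain l where "(g \<longlongrightarrow> l) (at b within {a..<b})"
    using uniformly_continuous_on_extension_at_closure[of "{a..<b}" g b] \<open>a < b\<close> by auto
  then have "(g \<longlongrightarrow> l) (at_left b)"
    using \<open>a < b\<close> by (subst at_within_nhd[of b "{a<..}" "{..<b}" "{a..<b}"]) auto
  then show thesis by (rule that)
qed

text \<open>The sets \<open>K t\<close> below are compact, nonempty by \<open>le\<close> and nested
  by \<open>decreasing\<close>, so they have a common point. It will be the horizontal part of the
  limiting null direction.\<close>

lemma common_direction:
  fixes v :: "real \<Rightarrow> 'a::euclidean_space" and w :: "real \<Rightarrow> real"
  assumes le: "\<And>t. t \<in> S \<Longrightarrow> \<bar>w t\<bar> \<le> norm (v t)"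
    and decreasing: "\<And>e s t. norm e = 1 \<Longrightarrow> s \<in> S \<Longrightarrow> t \<in> S \<Longrightarrow> s \<le> t \<Longrightarrow> v t \<bullet> e - w t \<le> v s \<bullet> e - w s"
  obtains e where "norm e = 1" "\<And>t. t \<in> S \<Longrightarrow> w t \<le> v t \<bullet> e"
proof (cases "S = {}")
  case True
  then show ?thesis using vector_choose_size[of 1] that by (metis empty_iff zero_le_one)
next
  case False
  define K where "K t = sphere 0 1 \<inter> {e. w t \<le> v t \<bullet> e}" for t
  have "\<Inter> (K ` S) \<noteq> {}"
  proof (rule compact_chain)
    fix A assume "A \<in> K ` S"
    then show "compact A"
      unfolding K_def by (auto intro!: compact_Int_closed closed_halfspace_ge)
  next
    have "K t \<noteq> {}" if "t \<in> S" for t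
    proof (cases "v t = 0")
      case True
      \<comment> \<open>With \<open>v t = 0\<close> the bound \<open>le\<close> forces
        \<open>w t = 0\<close>, so every unit vector lies in \<open>K t\<close>.\<close>
      obtain e :: 'a where "norm e = 1" using vector_choose_size[of 1] by auto
      then show ?thesis using True le[OF that] by (auto simp: K_def)
    next
      case False
      then have "v t /\<^sub>R norm (v t) \<in> K t"
        using le[OF that] by (auto simp: K_def dot_square_norm power2_eq_square field_simps)
      then show ?thesis by blast
    qed
    then show "{} \<notin> K ` S" by auto
  next
    have "K t \<subseteq> K s" if "s \<in> S" "t \<in> S" "s \<le> t" for s t
      using decreasing[OF _ that] by (force simp: K_def)
    then show "A \<subseteq> B \<or> B \<subseteq> A" if "A \<in> K ` S \<and> B \<in> K ` S" for A B
      using that by (metis imageE linear)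
  qed
  then obtain e where "\<And>t. t \<in> S \<Longrightarrow> e \<in> K t" by blast
  then show ?thesis using that[of e] False by (auto simp: K_def)
qed

text \<open>The analysis of the curve, detached from the surface: \<open>\<kappa>\<close> is the
  squared speed, \<open>increasing\<close> and \<open>decreasing\<close> express future causal
  acceleration, and \<open>divergent\<close> is what properness contributes.\<close>

lemma causal_velocity_limit:
  fixes u u' :: "real \<Rightarrow> 'a::euclidean_space" and z z' :: "real \<Rightarrow> real"
  assumes "a < b" and "0 \<le> \<kappa>"
    and u: "\<And>t. t \<in> {a..<b} \<Longrightarrow> (u has_vector_derivative u' t) (at t within {a..<b})"
    and z: "\<And>t. t \<in> {a..<b} \<Longrightarrow> (z has_vector_derivative z' t) (at t within {a..<b})"
    and speed: "\<And>t. t \<in> {a..<b} \<Longrightarrow> (norm (u' t))\<^sup>2 - (z' t)\<^sup>2 = \<kappa>"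
    and increasing: "\<And>s t. a \<le> s \<Longrightarrow> s \<le> t \<Longrightarrow> t < b \<Longrightarrow> z' s \<le> z' t"
    and decreasing: "\<And>e s t. norm e = 1 \<Longrightarrow> a \<le> s \<Longrightarrow> s \<le> t \<Longrightarrow> t < b \<Longrightarrow>
      u' t \<bullet> e - z' t \<le> u' s \<bullet> e - z' s"
    and divergent: "\<And>p q. (u \<longlongrightarrow> p) (at_left b) \<Longrightarrow> (z \<longlongrightarrow> q) (at_left b) \<Longrightarrow> False"
  obtains e y where "norm e = 1"
    and "filterlim z at_top (at_left b)"
    and "filterlim z' at_top (at_left b)"
    and "((\<lambda>t. u t - z t *\<^sub>R e) \<longlongrightarrow> y) (at_left b)"
    and "((\<lambda>t. u' t /\<^sub>R z' t) \<longlongrightarrow> e) (at_left b)"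
proof -
  have abs_z': "\<bar>z' t\<bar> \<le> norm (u' t)" if "t \<in> {a..<b}" for t
    by (rule power2_le_imp_le) (use speed[OF that] \<open>0 \<le> \<kappa>\<close> in simp_all)
  obtain e where e: "norm e = 1" and z'_le: "\<And>t. t \<in> {a..<b} \<Longrightarrow> z' t \<le> u' t \<bullet> e"
    using common_direction[of "{a..<b}" z' u'] abs_z' decreasing by auto
  have ltop: "filterlim z' at_top (at_left b)"
  proof (rule ccontr)
    assume "\<not> ?thesis"
    then obtain l where l: "\<forall>t\<in>{a..<b}. z' t \<le> l"
      using monotone_at_left_cases[of a b z'] \<open>a < b\<close> increasing by blast
    \<comment> \<open>\<open>l\<close> bounds \<open>z'\<close> from above and its initial value
      bounds it from below; \<open>speed\<close> then bounds \<open>u'\<close>.\<close>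
    define M where "M = max \<bar>l\<bar> \<bar>z' a\<bar>"
    have zM: "\<bar>z' t\<bar> \<le> M" if "t \<in> {a..<b}" for t
      using l that increasing[of a t] by (force simp: M_def)
    have uM: "norm (u' t) \<le> sqrt (\<kappa> + M\<^sup>2)" if "t \<in> {a..<b}" for t
      using speed[OF that] power_mono[OF zM[OF that] abs_ge_zero, of 2] by (intro real_le_rsqrt) simp
    obtain p where "(u \<longlongrightarrow> p) (at_left b)"
      using bounded_velocity_imp_convergent_at_left[OF \<open>a < b\<close> u uM] by blast
    moreover obtain q where "(z \<longlongrightarrow> q) (at_left b)"
      using bounded_velocity_imp_convergent_at_left[OF \<open>a < b\<close> z, of M] zM by auto
    ultimately show False by (rule divergent)
  qed
  have "\<forall>\<^sub>F t in at_left b. 0 < z' t" using ltop by (simp add: filterlim_at_top_dense)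
  \<comment> \<open>Positivity of \<open>z'\<close> after \<open>c\<close> is used twice: in the
    expanded square, where \<open>z'\<close> multiplies a nonpositive factor, and for the
    monotonicity of \<open>z\<close>.\<close>
  then obtain c where c: "a < c" "c < b" "0 < z' c"
    using eventually_conj[OF _ eventually_at_left_real[OF \<open>a < b\<close>]]
    by (smt (verit) eventually_happens trivial_limit_at_left_real greaterThanLessThan_iff)
  have z'_pos: "0 < z' t" if "t \<in> {c..<b}" for t
    using c increasing[of c t] that by auto
  have sub: "{c..<b} \<subseteq> {a..<b}" using c by auto
  note u_c = has_vector_derivative_within_subset[OF u sub, OF subsetD[OF sub]]
  note z_c = has_vector_derivative_within_subset[OF z sub, OF subsetD[OF sub]]
  have bound: "norm (u' t - z' t *\<^sub>R e) \<le> sqrt \<kappa>" if "t \<in> {c..<b}" for t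
  proof (rule real_le_rsqrt)
    have "(norm (u' t - z' t *\<^sub>R e))\<^sup>2 = (norm (u' t))\<^sup>2 - 2 * z' t * (u' t \<bullet> e) + (z' t)\<^sup>2"
      using e by (simp add: power2_norm_eq_inner algebra_simps inner_commute norm_eq_1)
        (simp add: power2_eq_square)
    also have "\<dots> = \<kappa> + 2 * z' t * (z' t - u' t \<bullet> e)"
      using speed[of t] sub that by (auto simp: algebra_simps power2_eq_square)
    also have "\<dots> \<le> \<kappa>"
      using z'_pos[OF that] z'_le[of t] sub that by (auto simp: mult_nonneg_nonpos)
    finally show "(norm (u' t - z' t *\<^sub>R e))\<^sup>2 \<le> \<kappa>" .
  qed
  have "((\<lambda>t. u t - z t *\<^sub>R e) has_vector_derivative u' t - z' t *\<^sub>R e) (at t within {c..<b})"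
    if "t \<in> {c..<b}" for t
    using that by (auto intro!: derivative_eq_intros u_c z_c simp: has_real_derivative_iff_has_vector_derivative)
  from bounded_velocity_imp_convergent_at_left[OF \<open>c < b\<close> this bound]
  obtain y where y: "((\<lambda>t. u t - z t *\<^sub>R e) \<longlongrightarrow> y) (at_left b)" .
  \<comment> \<open>Otherwise the increasing \<open>z\<close> would converge, and with it
    \<open>u\<close>, the sum of the convergent \<open>u t - z t *\<^sub>R e\<close> and
    \<open>z t *\<^sub>R e\<close>.\<close>
  have top: "filterlim z at_top (at_left b)"
  proof (rule ccontr)
    have "z s \<le> z t" if "c \<le> s" "s \<le> t" "t < b" for s t
      by (rule nonneg_vector_derivative_imp_mono[OF _ z_c])
        (use that z'_pos in \<open>auto simp: is_interval_co less_imp_le\<close>)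
    moreover assume "\<not> ?thesis"
    ultimately obtain q where q: "(z \<longlongrightarrow> q) (at_left b)"
      using monotone_at_left_cases[of c b z] c by blast
    have "(u \<longlongrightarrow> y + q *\<^sub>R e) (at_left b)"
      using tendsto_add[OF y tendsto_scaleR[OF q tendsto_const[of e]]] by simp
    then show False using q by (rule divergent)
  qed
  have "((\<lambda>t. u' t /\<^sub>R z' t - e) \<longlongrightarrow> 0) (at_left b)"
  proof (rule Lim_null_comparison)
    show "\<forall>\<^sub>F t in at_left b. norm (u' t /\<^sub>R z' t - e) \<le> sqrt \<kappa> / z' t"
      using eventually_at_left_real[OF \<open>c < b\<close>]
    proof eventually_elim
      case (elim t)
      then have t: "t \<in> {c..<b}" by auto
      have "u' t /\<^sub>R z' t - e = (u' t - z' t *\<^sub>R e) /\<^sub>R z' t"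
        using z'_pos[OF t] by (simp add: algebra_simps)
      then show ?case
        using bound[OF t] z'_pos[OF t] by (simp add: divide_inverse mult.commute)
    qed
    show "((\<lambda>t. sqrt \<kappa> / z' t) \<longlongrightarrow> 0) (at_left b)"
      using ltop by (rule real_tendsto_divide_at_top[OF tendsto_const])
  qed
  then have "((\<lambda>t. u' t /\<^sub>R z' t) \<longlongrightarrow> e) (at_left b)"
    by (simp add: Lim_null[symmetric])
  then show thesis by (rule that[OF e top ltop y])
qed

text \<open>Gives the upper bound for the null support value. Seen from \<open>v\<close>, far points
  of the curve lie almost in direction \<open>e\<close>, so their distance exceeds its component
  along \<open>e\<close> only by a vanishing amount.\<close>

lemma lipschitz_graph_null_bound:
  fixes u :: "'b \<Rightarrow> 'a::real_inner" and z :: "'b \<Rightarrow> real"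
  assumes F: "F \<noteq> bot" and e: "norm e = 1"
    and lip: "\<And>v w. \<bar>f v - f w\<bar> \<le> norm (v - w)"
    and z: "\<forall>\<^sub>F t in F. z t = f (u t)"
    and top: "filterlim z at_top F"
    and lim: "((\<lambda>t. u t - z t *\<^sub>R e) \<longlongrightarrow> y) F"
  shows "v \<bullet> e - f v \<le> y \<bullet> e"
proof -
  \<comment> \<open>Thus \<open>u t - v = z t *\<^sub>R e + d t\<close>, and \<open>A t\<close> is
    its component along \<open>e\<close>; \<open>d\<close> converges while \<open>A\<close>
    diverges.\<close>
  define d where "d t = u t - z t *\<^sub>R e - v" for t
  define A where "A t = e \<bullet> d t + z t" for t
  have d: "(d \<longlongrightarrow> y - v) F"
    unfolding d_def by (intro tendsto_intros lim)
  have A: "filterlim A at_top F"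
    unfolding A_def by (intro filterlim_tendsto_add_at_top[OF _ top, of _ "e \<bullet> (y - v)"] tendsto_intros d)
  have le: "0 \<le> f v + e \<bullet> d t + (norm (d t))\<^sup>2 / (2 * A t)"
    if "z t = f (u t)" "0 < A t" for t
  proof -
    have "(norm (u t - v))\<^sup>2 = (norm (z t *\<^sub>R e + d t))\<^sup>2"
      by (simp add: d_def)
    also have "\<dots> = (z t)\<^sup>2 + 2 * z t * (e \<bullet> d t) + (norm (d t))\<^sup>2"
      using e by (simp add: power2_norm_eq_inner algebra_simps inner_commute norm_eq_1)
        (simp add: power2_eq_square)
    also have "\<dots> \<le> (A t)\<^sup>2 + (norm (d t))\<^sup>2"
      by (simp add: A_def power2_eq_square algebra_simps)
    \<comment> \<open>Completing the square replaces the square root by its first-order bound, whose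
      correction is of order \<open>1 / A t\<close>.\<close>
    also have "\<dots> \<le> (A t + (norm (d t))\<^sup>2 / (2 * A t))\<^sup>2"
      using \<open>0 < A t\<close> by (simp add: power2_sum)
    finally have "norm (u t - v) \<le> A t + (norm (d t))\<^sup>2 / (2 * A t)"
      by (rule power2_le_imp_le) (use \<open>0 < A t\<close> in simp)
    then show ?thesis
      using lip[of "u t" v] \<open>z t = f (u t)\<close> by (simp add: A_def)
  qed
  have "((\<lambda>t. f v + e \<bullet> d t + (norm (d t))\<^sup>2 / (2 * A t)) \<longlongrightarrow> f v + e \<bullet> (y - v) + 0) F"
    by (intro tendsto_intros d real_tendsto_divide_at_top[of _ "(norm (y - v))\<^sup>2"]
        filterlim_tendsto_pos_mult_at_top[OF tendsto_const _ A]) auto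
  moreover have "\<forall>\<^sub>F t in F. 0 \<le> f v + e \<bullet> d t + (norm (d t))\<^sup>2 / (2 * A t)"
    using z filterlim_at_top_dense[THEN iffD1, OF A, rule_format, of 0]
    by eventually_elim (rule le)
  ultimately have "0 \<le> f v + e \<bullet> (y - v) + 0"
    using F by (intro tendsto_lowerbound)
  then show ?thesis
    by (simp add: inner_diff_right inner_commute)
qed

section \<open>Convergence in quotients\<close>

text \<open>The image of a saturated open set is open in the quotient, so convergence of classes can
  be read off representatives. As \<open>saturated\<close> ranges over all \<open>x\<close>, it also
  places \<open>v t\<close> in \<open>topspace X\<close>.\<close>

lemma eventually_saturated_of_limitin_quotient:
  assumes lim: "limitin (quotient_topology X q) (\<lambda>t. q (v t)) (q l) F"
    and U: "openin X U" and "l \<in> U"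
    and saturated: "\<And>x y. y \<in> U \<Longrightarrow> q x = q y \<Longrightarrow> x \<in> U"
  shows "\<forall>\<^sub>F t in F. v t \<in> U"
proof -
  have "{x \<in> topspace X. q x \<in> q ` U} = U"
    using openin_subset[OF U] saturated by auto
  then have "openin (quotient_topology X q) (q ` U)"
    using U openin_subset[OF U] by (auto simp: openin_quotient_topology)
  from limitinD[OF lim this] have "\<forall>\<^sub>F t in F. q (v t) \<in> q ` U"
    using \<open>l \<in> U\<close> by simp
  then show ?thesis
    by (rule eventually_mono) (auto intro: saturated)
qed

text \<open>A nonzero rescaling leaves the spanned line unchanged, and the projection to the
  quotient is continuous.\<close>

lemma converges_projectivelyI:
  fixes v :: "real \<Rightarrow> 'v::euclidean_space"
  assumes lim: "((\<lambda>t. v t /\<^sub>R r t) \<longlongrightarrow> w) F" and "w \<noteq> 0" and r: "\<forall>\<^sub>F t in F. r t \<noteq> 0"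
  shows "converges_projectively v w F"
proof -
  let ?X = "top_of_set (- {0 :: 'v})"
  have "\<forall>\<^sub>F t in F. v t /\<^sub>R r t \<noteq> 0"
    using tendsto_imp_eventually_ne[OF lim \<open>w \<noteq> 0\<close>] .
  then have "limitin ?X (\<lambda>t. v t /\<^sub>R r t) w F"
    using lim \<open>w \<noteq> 0\<close> by (simp add: limitin_subtopology)
  from continuous_map_limit[OF quotient_imp_continuous_map[OF quotient_map_quotient_topology] this]
  have "limitin (quotient_topology ?X (\<lambda>x. span {x})) (\<lambda>t. span {v t /\<^sub>R r t}) (span {w}) F"
    by (simp add: o_def)
  moreover have "\<forall>\<^sub>F t in F. span {v t /\<^sub>R r t} = span {v t}"
    using r by eventually_elim (simp add: span_image_scale[of "{v _}" "\<lambda>_. inverse (r _)", simplified])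
  ultimately show ?thesis
    unfolding converges_projectively_def by (rule limitin_transform_eventually[rotated])
qed

text \<open>A scale-invariant continuous function descends to projective space, because its
  preimages of open sets are saturated.\<close>

lemma converges_projectively_tendsto:
  fixes v :: "real \<Rightarrow> 'v::euclidean_space" and h :: "'v \<Rightarrow> 'b::topological_space"
  assumes v: "converges_projectively v w F"
    and cont: "continuous_on (- {0}) h" and scale: "\<And>c x. c \<noteq> 0 \<Longrightarrow> h (c *\<^sub>R x) = h x"
    and "w \<noteq> 0"
  shows "((\<lambda>t. h (v t)) \<longlongrightarrow> h w) F"
proof (rule topological_tendstoI)
  fix S assume S: "open S" "h w \<in> S"
  have "\<forall>\<^sub>F t in F. v t \<in> - {0} \<inter> h -` S"
    using v[unfolded converges_projectively_def]
  proof (rule eventually_saturated_of_limitin_quotient)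
    show "openin (top_of_set (- {0})) (- {0} \<inter> h -` S)"
      using cont S by (simp add: continuous_openin_preimage_gen)
    show "w \<in> - {0} \<inter> h -` S" using S \<open>w \<noteq> 0\<close> by simp
    fix x y :: 'v assume y: "y \<in> - {0} \<inter> h -` S" and eq: "span {x} = span {y}"
    obtain c where "y = c *\<^sub>R x"
      using span_base[of y "{y}"] eq by (auto simp: span_singleton)
    then show "x \<in> - {0} \<inter> h -` S"
      using y scale[of c x] by (cases "c = 0") auto
  qed
  then show "\<forall>\<^sub>F t in F. h (v t) \<in> S"
    by (rule eventually_mono) auto
qed

text \<open>Scale-invariant continuous functions agree at two projective limits, and the angle with
  \<open>y\<close> already tells the line of \<open>y\<close> from all others.\<close>

lemma converges_projectively_unique:
  fixes v :: "real \<Rightarrow> 'v::euclidean_space"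
  assumes "converges_projectively v x F" and "converges_projectively v y F"
    and F: "F \<noteq> bot" and "x \<noteq> 0" "y \<noteq> 0"
  obtains c where "y = c *\<^sub>R x"
proof -
  \<comment> \<open>\<open>h w\<close> is \<open>norm y\<close> times the absolute cosine of the
    angle between \<open>w\<close> and \<open>y\<close>. Equal values at \<open>x\<close> and
    \<open>y\<close> mean equality in the Cauchy-Schwarz inequality.\<close>
  define h where "h w = \<bar>w \<bullet> y\<bar> / norm w" for w
  have "((\<lambda>t. h (v t)) \<longlongrightarrow> h w) F" if "converges_projectively v w F" "w \<noteq> 0" for w
    using that(1) _ _ that(2)
    by (rule converges_projectively_tendsto) (auto simp: h_def abs_mult intro!: continuous_intros)
  then have "h x = h y"
    using tendsto_unique[OF F] assms by metis
  then have "\<bar>x \<bullet> y\<bar> = norm x * norm y"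
    using \<open>x \<noteq> 0\<close> \<open>y \<noteq> 0\<close> by (simp add: h_def dot_square_norm power2_eq_square field_simps)
  then have "norm x *\<^sub>R y = norm y *\<^sub>R x \<or> norm x *\<^sub>R y = (- norm y) *\<^sub>R x"
    by (simp add: norm_cauchy_schwarz_abs_eq)
  then obtain c where "norm x *\<^sub>R y = c *\<^sub>R x" by blast
  then have "y = (c / norm x) *\<^sub>R x"
    using \<open>x \<noteq> 0\<close> by (metis divide_inverse_commute norm_eq_zero scaleR_one scaleR_scaleR left_inverse)
  then show thesis by (rule that)
qed

section \<open>Asymptotic lines as limits in the quotient by a direction\<close>

lemma direction_space_line:
  "direction_space {x + r *\<^sub>R w |r. True} = span {w}"
proof -
  have "\<exists>r s. k *\<^sub>R w = (x + r *\<^sub>R w) - (x + s *\<^sub>R w)" for k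
    by (rule exI[of _ k], rule exI[of _ 0]) simp
  moreover have "\<exists>k. (x + r *\<^sub>R w) - (x + s *\<^sub>R w) = k *\<^sub>R w" for r s
    by (rule exI[of _ "r - s"]) (simp add: algebra_simps)
  ultimately show ?thesis
    unfolding direction_space_def span_singleton by fastforce
qed

lemma coset_line: "(\<lambda>w'. x + w') ` span {w} = {x + r *\<^sub>R w |r. True}"
  by (auto simp: span_singleton)

lemma affine_line: "affine {x + r *\<^sub>R w |r. True}"
  unfolding coset_line[symmetric] by (simp add: affine_translation[symmetric] subspace_imp_affine)

lemma asymptotic_to_line_iff:
  "asymptotic_to \<gamma> {x + r *\<^sub>R w |r. True} F \<longleftrightarrow>
    limitin (quotient_topology euclidean (\<lambda>x. {x + r *\<^sub>R w |r. True}))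
      (\<lambda>t. {\<gamma> t + r *\<^sub>R w |r. True}) {x + r *\<^sub>R w |r. True} F"
  unfolding asymptotic_to_def direction_space_line coset_line using affine_line[of x w] by auto

text \<open>Subtracting a multiple of \<open>w\<close> moves \<open>\<gamma> t\<close> along its own
  line, so the class stays the same while the representatives converge.\<close>

lemma asymptotic_to_lineI:
  fixes \<gamma> :: "real \<Rightarrow> 'v::euclidean_space"
  assumes "((\<lambda>t. \<gamma> t - z t *\<^sub>R w) \<longlongrightarrow> x) F"
  shows "asymptotic_to \<gamma> {x + r *\<^sub>R w |r. True} F"
proof -
  have "{\<gamma> t - z t *\<^sub>R w + r *\<^sub>R w |r. True} = {\<gamma> t + r *\<^sub>R w |r. True}" for t
  proof safe
    fix r
    show "\<exists>s. \<gamma> t - z t *\<^sub>R w + r *\<^sub>R w = \<gamma> t + s *\<^sub>R w \<and> True"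
      by (rule exI[of _ "r - z t"]) (simp add: algebra_simps)
    show "\<exists>s. \<gamma> t + r *\<^sub>R w = \<gamma> t - z t *\<^sub>R w + s *\<^sub>R w \<and> True"
      by (rule exI[of _ "r + z t"]) (simp add: algebra_simps)
  qed
  moreover have "limitin euclidean (\<lambda>t. \<gamma> t - z t *\<^sub>R w) x F"
    using assms by simp
  from continuous_map_limit[OF quotient_imp_continuous_map[OF quotient_map_quotient_topology] this,
      of "\<lambda>x. {x + r *\<^sub>R w |r. True}"]
  have "limitin (quotient_topology euclidean (\<lambda>x. {x + r *\<^sub>R w |r. True}))
      (\<lambda>t. {\<gamma> t - z t *\<^sub>R w + r *\<^sub>R w |r. True}) {x + r *\<^sub>R w |r. True} F"
    by (simp add: o_def)
  ultimately show ?thesis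
    unfolding asymptotic_to_line_iff by simp
qed

text \<open>A linear map that kills \<open>w\<close> is constant on lines parallel to
  \<open>w\<close> and hence factors through the quotient.\<close>

lemma asymptotic_to_line_tendsto:
  fixes \<gamma> :: "real \<Rightarrow> 'v::euclidean_space" 
  assumes asym: "asymptotic_to \<gamma> {x + r *\<^sub>R w |r. True} F"
    and P: "bounded_linear P" "P w = 0"
  shows "((\<lambda>t. P (\<gamma> t)) \<longlongrightarrow> P x) F"
proof (rule topological_tendstoI)
  fix S assume S: "open S" "P x \<in> S"
  interpret P: bounded_linear P by fact
  show "\<forall>\<^sub>F t in F. P (\<gamma> t) \<in> S"
  proof -
    have "\<forall>\<^sub>F t in F. \<gamma> t \<in> P -` S"
      using asym[unfolded asymptotic_to_line_iff]
    proof (rule eventually_saturated_of_limitin_quotient)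
      show "openin euclidean (P -` S)"
        using S by (auto intro!: open_vimage P.continuous_on)
      show "x \<in> P -` S" using S by simp
      fix a b assume "b \<in> P -` S" and ab: "{a + r *\<^sub>R w |r. True} = {b + r *\<^sub>R w |r. True}"
      have "a \<in> {a + r *\<^sub>R w |r. True}" by (auto intro: exI[of _ 0])
      then obtain r where "a = b + r *\<^sub>R w" using ab by blast
      then show "a \<in> P -` S" using \<open>b \<in> P -` S\<close> P(2) by (simp add: P.add P.scaleR)
    qed
    then show ?thesis by simp
  qed
qed

lemma asymptotic_to_line_unique:
  fixes \<gamma> :: "real \<Rightarrow> 'v::euclidean_space"
  assumes "asymptotic_to \<gamma> {x + r *\<^sub>R w |r. True} F" "asymptotic_to \<gamma> {y + r *\<^sub>R w |r. True} F"
    and F: "F \<noteq> bot"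
  shows "{x + r *\<^sub>R w |r. True} = {y + r *\<^sub>R w |r. True}"
proof -
  \<comment> \<open>The orthogonal projection along \<open>w\<close>. For \<open>w = 0\<close>,
    division by zero makes it the identity and the lines are points.\<close>
  define P where "P v = v - ((v \<bullet> w) / (w \<bullet> w)) *\<^sub>R w" for v
  have "bounded_linear P"
    unfolding P_def by (intro bounded_linear_sub bounded_linear_ident bounded_linear_scaleR_const
        bounded_linear_divide[THEN bounded_linear_compose] bounded_linear_inner_left)
  moreover have "P w = 0"
    by (cases "w = 0") (simp_all add: P_def)
  ultimately have "P x = P y"
    using tendsto_unique[OF F] asymptotic_to_line_tendsto assms by metis
  define k where "k = ((x \<bullet> w) - (y \<bullet> w)) / (w \<bullet> w)"
  have x: "x = y + k *\<^sub>R w"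
    using \<open>P x = P y\<close> unfolding P_def k_def by (simp add: algebra_simps diff_divide_distrib)
  show ?thesis
  proof safe
    fix r
    show "\<exists>s. x + r *\<^sub>R w = y + s *\<^sub>R w \<and> True"
      by (rule exI[of _ "k + r"]) (simp add: x algebra_simps)
    show "\<exists>s. y + r *\<^sub>R w = x + s *\<^sub>R w \<and> True"
      by (rule exI[of _ "r - k"]) (simp add: x algebra_simps)
  qed
qed

section \<open>Geodesics on a spacelike graph\<close>

lemma graph_map_eq:
  "graph_map f x = x$1 *\<^sub>R axis 1 1 + x$2 *\<^sub>R axis 2 1 + f x *\<^sub>R axis 3 1"
  by (simp add: vec_eq_iff forall_3 graph_map_def axis_def)

lemma graph_map_has_derivative:
  assumes "(f has_derivative f') (at x within S)"
  shows "(graph_map f has_derivative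
    (\<lambda>h. h$1 *\<^sub>R axis 1 1 + h$2 *\<^sub>R axis 2 1 + f' h *\<^sub>R axis 3 1)) (at x within S)"
  unfolding graph_map_eq[abs_def]
  by (auto intro!: derivative_eq_intros assms bounded_linear_imp_has_derivative)

text \<open>\<open>g\<close> is an eigenvector of \<open>A\<close> for the eigenvalue
  \<open>1 - (norm g)\<^sup>2\<close>, which in dimension two is also the determinant. Applied to
  the induced metric, it raises the index of the gradient.\<close>

lemma rank_one_update_mult_inverse:
  fixes g :: "real^2" and A :: "real^2^2"
  assumes A: "\<And>i j. A $ i $ j = (if i = j then 1 else 0) - g $ i * g $ j"
    and g: "norm g < 1"
  shows "matrix_inv A *v g = g /\<^sub>R (1 - (norm g)\<^sup>2)"
proof -
  have norm_g: "(norm g)\<^sup>2 = (g $ 1)\<^sup>2 + (g $ 2)\<^sup>2"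
    by (simp only: power2_norm_eq_inner) (simp add: inner_vec_def sum_2 power2_eq_square)
  have pos: "0 < 1 - (norm g)\<^sup>2"
    using g by (simp add: abs_square_less_1)
  have "det A = 1 - (norm g)\<^sup>2"
    by (simp only: norm_g) (simp add: det_2 A power2_eq_square algebra_simps)
  then have "invertible A"
    using pos by (simp add: invertible_det_nz)
  then have inv: "matrix_inv A ** A = mat 1"
    unfolding invertible_def matrix_inv_def by (rule someI2_ex) simp
  have "A *v g = (1 - (norm g)\<^sup>2) *\<^sub>R g"
    by (simp only: norm_g)
      (simp add: vec_eq_iff matrix_vector_mult_def sum_2 forall_2 A power2_eq_square algebra_simps)
  then have "(1 - (norm g)\<^sup>2) *\<^sub>R (matrix_inv A *v g) = g"
    by (metis inv matrix_vector_mul_assoc matrix_vector_mul_lid matrix_vector_mult_scaleR)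
  then show ?thesis
    using pos by (metis less_irrefl scaleR_one scaleR_scaleR left_inverse)
qed

text \<open>Fixing both derivatives as bounded linear maps makes the Hessian available as a bilinear
  form \<open>H x\<close>.\<close>

locale spacelike_graph =
  fixes f :: "real^2 \<Rightarrow> real"
    and f' :: "real^2 \<Rightarrow> (real^2) \<Rightarrow>\<^sub>L real" and H :: "real^2 \<Rightarrow> (real^2) \<Rightarrow>\<^sub>L (real^2) \<Rightarrow>\<^sub>L real"
  assumes df: "(f has_derivative blinfun_apply (f' x)) (at x)"
    and d2f: "(f' has_derivative blinfun_apply (H x)) (at x)"
    and convex: "convex_on UNIV f"
    and onorm_less_1: "onorm (blinfun_apply (f' x)) < 1"
begin

definition grad :: "real^2 \<Rightarrow> real^2" where
  "grad x = (\<chi> i. f' x (axis i 1))"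

lemma f'_eq: "f' x v = grad x \<bullet> v"
proof -
  have "f' x v = f' x (\<Sum>i\<in>UNIV. v $ i *\<^sub>R axis i 1)"
    by (simp add: basis_expansion flip: scalar_mult_eq_scaleR)
  then show ?thesis
    by (simp add: blinfun.sum_right blinfun.scaleR_right grad_def inner_vec_def mult.commute)
qed

text \<open>Evaluate \<open>f' x\<close> at its own gradient and cancel one factor.\<close>

lemma norm_grad: "norm (grad x) < 1"
proof (cases "grad x = 0")
  case False
  have "(norm (grad x))\<^sup>2 = f' x (grad x)"
    by (simp add: f'_eq power2_norm_eq_inner)
  also have "\<dots> \<le> onorm (f' x) * norm (grad x)"
    using onorm[OF blinfun.bounded_linear_right, of "f' x" "grad x"] by simp
  finally have "norm (grad x) \<le> onorm (f' x)"
    using False by (simp add: power2_eq_square)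
  then show ?thesis using onorm_less_1[of x] by simp
qed simp

lemma lipschitz: "\<bar>f v - f w\<bar> \<le> norm (v - w)"
  using differentiable_bound[of UNIV f "\<lambda>x. blinfun_apply (f' x)" 1 v w] df onorm_less_1
  by (simp add: less_imp_le)

lemma H_symmetric: "H x k h = H x h k"
  by (rule second_derivative_symmetric[OF df d2f])

text \<open>The coordinate tangent vectors have the standard basis as horizontal part and the
  partial derivatives of \<open>f\<close> as height; the minus sign of \<open>lorentz\<close>
  produces the rank-one term.\<close>

lemma induced_metric_eq:
  "induced_metric f x $ i $ j = (if i = j then 1 else 0) - grad x $ i * grad x $ j"
proof -
  have "partial i (graph_map f) x =
      axis i 1 $ 1 *\<^sub>R axis 1 1 + axis i 1 $ 2 *\<^sub>R axis 2 1 + f' x (axis i 1) *\<^sub>R axis 3 1" for i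
    unfolding partial_def frechet_derivative_at[OF graph_map_has_derivative[OF df], symmetric] ..
  then show ?thesis
    using exhaust_2[of i] exhaust_2[of j]
    by (auto simp: induced_metric_def lorentz_def grad_def axis_def)
qed

lemma partial_induced_metric:
  "partial k (\<lambda>y. induced_metric f y $ i $ j) x =
    - (H x (axis k 1) (axis i 1) * grad x $ j + grad x $ i * H x (axis k 1) (axis j 1))"
proof -
  have D: "((\<lambda>y. f' y v) has_derivative (\<lambda>h. H x h v)) (at x)" for v
    by (rule bounded_linear.has_derivative[OF blinfun.bounded_linear_left d2f])
  have "((\<lambda>y. induced_metric f y $ i $ j) has_derivative
      (\<lambda>h. - (H x h (axis i 1) * grad x $ j + grad x $ i * H x h (axis j 1)))) (at x)"
    unfolding induced_metric_eq grad_def vec_lambda_beta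
    by (rule has_derivative_eq_rhs[OF has_derivative_diff[OF has_derivative_const
          has_derivative_mult[OF D D]]]) (simp add: fun_eq_iff)
  from frechet_derivative_at[OF this, symmetric] show ?thesis
    by (simp add: partial_def)
qed

text \<open>By symmetry of \<open>H\<close>, the terms containing \<open>grad x $ i\<close> or
  \<open>grad x $ j\<close> cancel among the three partial derivatives. What remains is a multiple
  of the gradient, on which the inverse metric acts as a scalar.\<close>

lemma christoffel_eq:
  "christoffel (induced_metric f) x k i j =
    - (H x (axis i 1) (axis j 1) / (1 - (norm (grad x))\<^sup>2)) * grad x $ k"
proof -
  have "christoffel (induced_metric f) x k i j =
      (\<Sum>l\<in>UNIV. - H x (axis i 1) (axis j 1) * (matrix_inv (induced_metric f x) $ k $ l * grad x $ l))"
    unfolding christoffel_def partial_induced_metric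
  proof (rule sum.cong[OF refl])
    fix l
    show "matrix_inv (induced_metric f x) $ k $ l *
      (- (H x (axis i 1) (axis j 1) * grad x $ l + grad x $ j * H x (axis i 1) (axis l 1)) +
       - (H x (axis j 1) (axis i 1) * grad x $ l + grad x $ i * H x (axis j 1) (axis l 1)) -
       - (H x (axis l 1) (axis i 1) * grad x $ j + grad x $ i * H x (axis l 1) (axis j 1))) / 2 =
      - H x (axis i 1) (axis j 1) * (matrix_inv (induced_metric f x) $ k $ l * grad x $ l)"
      using H_symmetric[of x "axis j 1" "axis i 1"] H_symmetric[of x "axis l 1" "axis i 1"]
        H_symmetric[of x "axis l 1" "axis j 1"]
      by (simp add: algebra_simps)
  qed
  also have "\<dots> = - H x (axis i 1) (axis j 1) * (matrix_inv (induced_metric f x) *v grad x) $ k"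
    by (simp add: matrix_vector_mult_def sum_distrib_left)
  also have "\<dots> = - H x (axis i 1) (axis j 1) * (grad x /\<^sub>R (1 - (norm (grad x))\<^sup>2)) $ k"
    by (simp add: rank_one_update_mult_inverse[OF induced_metric_eq norm_grad])
  finally show ?thesis
    by (simp add: divide_inverse)
qed

lemma H_expand: "H x v v = (\<Sum>i\<in>UNIV. \<Sum>j\<in>UNIV. H x (axis i 1) (axis j 1) * v $ i * v $ j)"
proof -
  have "H x v v = H x (\<Sum>i\<in>UNIV. v $ i *\<^sub>R axis i 1) (\<Sum>i\<in>UNIV. v $ i *\<^sub>R axis i 1)"
    by (simp add: basis_expansion flip: scalar_mult_eq_scaleR)
  then show ?thesis
    by (simp add: blinfun.sum_right blinfun.sum_left blinfun.scaleR_right blinfun.scaleR_left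
        sum_distrib_left mult_ac H_symmetric)
qed

text \<open>The Christoffel symbols turn the geodesic equation into
  \<open>u'' t = \<mu> t *\<^sub>R grad (u t)\<close>. With the height included, the acceleration is
  \<open>\<mu>\<close> times the Lorentzian normal (grad, 1) of the graph.\<close>

lemma geodesic_acceleration:
  assumes "metric_geodesic_on (induced_metric f) I u"
  obtains u' \<mu> where
    "\<And>t. t \<in> I \<Longrightarrow> (u has_vector_derivative u' t) (at t within I)"
    "\<And>t. t \<in> I \<Longrightarrow> ((\<lambda>t. f (u t)) has_vector_derivative grad (u t) \<bullet> u' t) (at t within I)"
    "\<And>t. t \<in> I \<Longrightarrow> (u' has_vector_derivative \<mu> t *\<^sub>R grad (u t)) (at t within I)"
    "\<And>t. t \<in> I \<Longrightarrow> ((\<lambda>t. grad (u t) \<bullet> u' t) has_vector_derivative \<mu> t) (at t within I)"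
    "\<And>t. 0 \<le> \<mu> t"
proof -
  obtain u' u'' where u': "\<And>t. t \<in> I \<Longrightarrow> (u has_vector_derivative u' t) (at t within I)"
    and u'': "\<And>t. t \<in> I \<Longrightarrow> (u' has_vector_derivative u'' t) (at t within I)"
    and geo: "\<And>t k. t \<in> I \<Longrightarrow> u'' t $ k + (\<Sum>i\<in>UNIV. \<Sum>j\<in>UNIV.
      christoffel (induced_metric f) (u t) k i j * u' t $ i * u' t $ j) = 0"
    using assms unfolding metric_geodesic_on_def by blast
  define \<mu> where "\<mu> t = H (u t) (u' t) (u' t) / (1 - (norm (grad (u t)))\<^sup>2)" for t
  have pos: "0 < 1 - (norm (grad x))\<^sup>2" for x
    using norm_grad[of x] by (simp add: abs_square_less_1)
  have u''_eq: "u'' t = \<mu> t *\<^sub>R grad (u t)" if "t \<in> I" for t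
  proof -
    have "u'' t $ k = \<mu> t * grad (u t) $ k" for k
    proof -
      have "u'' t $ k = - (\<Sum>i\<in>UNIV. \<Sum>j\<in>UNIV.
          christoffel (induced_metric f) (u t) k i j * u' t $ i * u' t $ j)"
        using geo[OF that, of k] by simp
      also have "\<dots> = \<mu> t * grad (u t) $ k"
        unfolding \<mu>_def H_expand christoffel_eq
        by (simp add: sum_negf sum_distrib_left sum_distrib_right sum_divide_distrib mult_ac)
      finally show ?thesis .
    qed
    then show ?thesis by (simp add: vec_eq_iff)
  qed
  have fu: "((\<lambda>t. f (u t)) has_vector_derivative grad (u t) \<bullet> u' t) (at t within I)" if "t \<in> I" for t
    using has_derivative_compose[OF u'[OF that, unfolded has_vector_derivative_def] df]
    by (simp add: has_vector_derivative_def f'_eq)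
  have f'u: "((\<lambda>t. f' (u t)) has_vector_derivative H (u t) (u' t)) (at t within I)" if "t \<in> I" for t
    using has_derivative_compose[OF u'[OF that, unfolded has_vector_derivative_def] d2f]
    by (simp add: has_vector_derivative_def blinfun.scaleR_right)
  have fu': "((\<lambda>t. grad (u t) \<bullet> u' t) has_vector_derivative \<mu> t) (at t within I)" if "t \<in> I" for t
  proof -
    \<comment> \<open>In the second derivative of the height, the acceleration of \<open>u\<close>
      contributes \<open>\<mu> t * (norm (grad (u t)))\<^sup>2\<close> and the Hessian supplies
      exactly the rest of \<open>\<mu> t\<close>.\<close>
    have "f' (u t) (\<mu> t *\<^sub>R grad (u t)) + H (u t) (u' t) (u' t) = \<mu> t"
    proof -
      have "H (u t) (u' t) (u' t) = \<mu> t * (1 - (norm (grad (u t)))\<^sup>2)"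
        using pos[of "u t"] by (simp add: \<mu>_def)
      then show ?thesis
        by (simp add: f'_eq power2_norm_eq_inner algebra_simps)
    qed
    then show ?thesis
      using bounded_bilinear.has_vector_derivative[OF bounded_bilinear_blinfun_apply f'u u'', OF that that]
      by (simp add: u''_eq[OF that] flip: f'_eq)
  qed
  show thesis
  proof (rule that[OF u' fu _ fu'])
    show "(u' has_vector_derivative \<mu> t *\<^sub>R grad (u t)) (at t within I)" if "t \<in> I" for t
      using u''[OF that] by (simp add: u''_eq[OF that])
    show "0 \<le> \<mu> t" for t
      unfolding \<mu>_def
      using convex_on_imp_second_derivative_nonneg[OF df d2f convex] pos[of "u t"] by simp
  qed
qed

end

section \<open>Minkowski space\<close>

definition lift :: "real^2 \<Rightarrow> real \<Rightarrow> real^3" where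
  "lift x z = vector [x$1, x$2, z]"

definition dir :: "real \<Rightarrow> real^2" where
  "dir \<theta> = vector [cos \<theta>, sin \<theta>]"

lemma lift_eq: "lift x z = x$1 *\<^sub>R axis 1 1 + x$2 *\<^sub>R axis 2 1 + z *\<^sub>R axis 3 1"
  by (simp add: vec_eq_iff forall_3 lift_def axis_def)

lemma graph_map_lift: "graph_map f x = lift x (f x)"
  by (simp add: graph_map_def lift_def)

lemma null_vec_lift: "null_vec \<theta> = lift (dir \<theta>) 1"
  by (simp add: null_vec_def lift_def dir_def)

lemma null_vec_nonzero: "null_vec \<theta> \<noteq> 0"
  by (simp add: null_vec_def vec_eq_iff forall_3)

lemma norm_dir: "norm (dir \<theta>) = 1"
  by (simp add: norm_eq_1 inner_vec_def sum_2 dir_def flip: power2_eq_square)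

lemma dir_surj:
  assumes "norm e = 1"
  obtains \<theta> where "\<theta> \<in> circle" "dir \<theta> = e"
proof -
  have "(e$1)\<^sup>2 + (e$2)\<^sup>2 = 1"
    using assms by (simp add: norm_eq_1 inner_vec_def sum_2 power2_eq_square)
  then obtain \<theta> where "0 \<le> \<theta>" "\<theta> < 2 * pi" "e$1 = cos \<theta>" "e$2 = sin \<theta>"
    by (rule sincos_total_2pi)
  then show thesis
    using that[of \<theta>] by (simp add: circle_def dir_def vec_eq_iff forall_2)
qed

lemma dir_inject:
  assumes "\<theta> \<in> circle" "\<theta>' \<in> circle" and "dir \<theta> = dir \<theta>'"
  shows "\<theta> = \<theta>'"
proof -
  have "sin \<theta> = sin \<theta>' \<and> cos \<theta> = cos \<theta>'"
    using \<open>dir \<theta> = dir \<theta>'\<close> by (simp add: dir_def vec_eq_iff forall_2)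
  then obtain n :: int where n: "\<theta> = \<theta>' + 2 * pi * n"
    by (auto simp: sin_cos_eq_iff)
  then have "\<bar>2 * pi * n\<bar> < 2 * pi * 1"
    using assms(1,2) by (auto simp: circle_def)
  then have "\<bar>real_of_int n\<bar> < 1"
    by (simp add: abs_mult)
  then show ?thesis using n by simp
qed

lemma lorentz_lift: "lorentz (lift x z) (lift y w) = x \<bullet> y - z * w"
  by (simp add: lorentz_def lift_def inner_vec_def sum_2)

lemma lift_diff_scaleR: "lift x z - r *\<^sub>R lift y w = lift (x - r *\<^sub>R y) (z - r * w)"
  by (simp add: vec_eq_iff forall_3 lift_def)

lemma tendsto_lift:
  assumes "(u \<longlongrightarrow> x) F" "(z \<longlongrightarrow> r) F"
  shows "((\<lambda>t. lift (u t) (z t)) \<longlongrightarrow> lift x r) F"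
  unfolding lift_eq by (intro tendsto_intros assms)

lemma has_vector_derivative_lift:
  assumes "(u has_vector_derivative u') (at t within S)" "(z has_vector_derivative z') (at t within S)"
  shows "((\<lambda>t. lift (u t) (z t)) has_vector_derivative lift u' z') (at t within S)"
proof -
  have "linear (\<lambda>p. lift (fst p) (snd p))"
    by (rule linearI) (simp_all add: lift_def vec_eq_iff forall_3)
  then have "bounded_linear (\<lambda>p. lift (fst p) (snd p))"
    by (simp add: linear_conv_bounded_linear)
  from bounded_linear.has_vector_derivative[OF this has_vector_derivative_Pair[OF assms]]
  show ?thesis by simp
qed

text \<open>Null vectors are normalized to third coordinate 1, so proportional ones coincide, and
  \<open>circle\<close> has one representative of each angle.\<close>

lemma converges_projectively_null_vec_iff:
  assumes lim: "converges_projectively v (null_vec \<theta>') F" and F: "F \<noteq> bot"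
    and "\<theta> \<in> circle" "\<theta>' \<in> circle"
  shows "converges_projectively v (null_vec \<theta>) F \<longleftrightarrow> \<theta> = \<theta>'"
proof
  assume "converges_projectively v (null_vec \<theta>) F"
  from converges_projectively_unique[OF lim this F null_vec_nonzero null_vec_nonzero]
  obtain c where c: "null_vec \<theta> = c *\<^sub>R null_vec \<theta>'" .
  from arg_cong[OF c, of "\<lambda>v. v $ 3"] have "c = 1"
    by (simp add: null_vec_def)
  with c have "dir \<theta> = dir \<theta>'"
    by (simp add: null_vec_def dir_def vec_eq_iff forall_3 forall_2)
  then show "\<theta> = \<theta>'" using assms(3,4) by (rule dir_inject[rotated 2])
qed (use lim in simp)

section \<open>Half-open time intervals, their end filter and proper maps on them\<close>

lemma to_end_ereal: "to_end (ereal b) = at_left b"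
proof (rule filter_eqI)
  fix P
  have "eventually P (to_end (ereal b)) \<longleftrightarrow>
      (\<exists>Q. (\<forall>\<^sub>F t in at_left b. Q (ereal t)) \<and> (\<forall>t. Q (ereal t) \<longrightarrow> P t))"
    by (simp add: to_end_def at_left_ereal eventually_filtercomap eventually_filtermap)
  also have "\<dots> \<longleftrightarrow> eventually P (at_left b)"
  proof
    assume "eventually P (at_left b)"
    \<comment> \<open>A predicate on the reals extends along \<open>real_of_ereal\<close>, a left
      inverse of \<open>ereal\<close>.\<close>
    then show "\<exists>Q. (\<forall>\<^sub>F t in at_left b. Q (ereal t)) \<and> (\<forall>t. Q (ereal t) \<longrightarrow> P t)"
      by (intro exI[of _ "\<lambda>r. P (real_of_ereal r)"]) simp
  qed (blast intro: eventually_mono)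
  finally show "eventually P (to_end (ereal b)) \<longleftrightarrow> eventually P (at_left b)" .
qed

text \<open>The half-line contains intervals of every integer length. This rules out infinite time
  for finite length at constant positive speed.\<close>

lemma emeasure_lborel_Ici: "emeasure lborel {a::real..} = \<infinity>"
proof (rule ccontr)
  assume "emeasure lborel {a..} \<noteq> \<infinity>"
  then obtain n where n: "emeasure lborel {a..} < of_nat n"
    using ennreal_Ex_less_of_nat by (auto simp: less_top)
  have "of_nat n = emeasure lborel {a..a + n}"
    by (simp add: ennreal_of_nat_eq_real_of_nat)
  also have "\<dots> \<le> emeasure lborel {a..}"
    by (rule emeasure_mono) auto
  finally show False using n by simp
qed

text \<open>The preimage of \<open>K\<close> is compact, hence closed in the reals, yet it contains
  all times close to \<open>b\<close>; so it would contain \<open>b\<close> itself.\<close>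

lemma proper_map_no_limit:
  fixes \<gamma> :: "real \<Rightarrow> 'a::topological_space"
  assumes proper: "proper_map (top_of_set {a..<b}) (top_of_set \<Sigma>) \<gamma>"
    and K: "compact K" "K \<subseteq> \<Sigma>" and ev: "\<forall>\<^sub>F t in at_left b. \<gamma> t \<in> K" and "a < b"
  shows False
proof -
  define C where "C = {t \<in> {a..<b}. \<gamma> t \<in> K}"
  have "compactin (top_of_set {a..<b}) C"
    using compactin_proper_map_preimage[OF proper, of K] K by (simp add: C_def compactin_subtopology)
  then have "compact C" by (simp add: compactin_subtopology)
  have "\<forall>\<^sub>F t in at_left b. t \<in> C"
    using ev eventually_at_left_real[OF \<open>a < b\<close>] by eventually_elim (auto simp: C_def)
  then have "b \<in> C"
    using Lim_in_closed_set[OF compact_imp_closed[OF \<open>compact C\<close>] _ _ tendsto_ident_at] by simp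
  then show False by (simp add: C_def)
qed

lemma halfopen_ereal: "halfopen (ereal b) = {0..<b}"
  by (auto simp: halfopen_def)

lemma halfopen_infinity: "halfopen \<infinity> = {0..}"
  by (auto simp: halfopen_def)

text \<open>\<open>velocity\<close> is a chosen derivative, and this nontriviality makes it unique,
  also at the initial time 0.\<close>

lemma at_within_halfopen_neq_bot:
  assumes "t \<in> halfopen T"
  shows "at t within halfopen T \<noteq> bot"
proof -
  obtain r where "t < r" "ereal r < T"
    using assms ereal_dense2[of t T] by (auto simp: halfopen_def)
  then have "{t..r} \<subseteq> halfopen T"
    using assms by (auto simp: halfopen_def intro: le_less_trans[of _ "ereal r"])
  then have "t islimpt halfopen T"
    using islimpt_subset[of t "{t..r}"] \<open>t < r\<close> by (auto simp: islimpt_Icc)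
  then show ?thesis by (simp add: trivial_limit_within)
qed

lemma is_interval_halfopen: "is_interval (halfopen T)"
  by (auto simp: is_interval_1 halfopen_def intro: le_less_trans[OF ereal_less_eq(3)[THEN iffD2]])

section \<open>Conserved and monotone quantities along a geodesic\<close>

context spacelike_graph
begin

text \<open>The acceleration is orthogonal to the velocity, which conserves \<open>\<kappa>\<close>,
  and it is a nonnegative multiple of (grad, 1) with gradient of norm below 1, which gives both
  monotonicities.\<close>

lemma geodesic_velocity:
  assumes geo: "geodesic_on f I \<gamma>" and I: "is_interval I"
    and nontriv: "\<And>t. t \<in> I \<Longrightarrow> at t within I \<noteq> bot"
  obtains \<kappa> u u' z' where "0 \<le> \<kappa>"
    "\<And>t. t \<in> I \<Longrightarrow> \<gamma> t = lift (u t) (f (u t))"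
    "\<And>t. t \<in> I \<Longrightarrow> velocity I \<gamma> t = lift (u' t) (z' t)"
    "\<And>t. t \<in> I \<Longrightarrow> (u has_vector_derivative u' t) (at t within I)"
    "\<And>t. t \<in> I \<Longrightarrow> ((\<lambda>t. f (u t)) has_vector_derivative z' t) (at t within I)"
    "\<And>t. t \<in> I \<Longrightarrow> (norm (u' t))\<^sup>2 - (z' t)\<^sup>2 = \<kappa>"
    "\<And>t. u' t \<noteq> 0 \<Longrightarrow> \<bar>z' t\<bar> < norm (u' t)"
    "\<And>s t. s \<in> I \<Longrightarrow> t \<in> I \<Longrightarrow> s \<le> t \<Longrightarrow> z' s \<le> z' t"
    "\<And>e s t. norm e = 1 \<Longrightarrow> s \<in> I \<Longrightarrow> t \<in> I \<Longrightarrow> s \<le> t \<Longrightarrow> u' t \<bullet> e - z' t \<le> u' s \<bullet> e - z' s"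
proof -
  obtain u where \<gamma>: "\<And>t. t \<in> I \<Longrightarrow> \<gamma> t = lift (u t) (f (u t))"
    and "metric_geodesic_on (induced_metric f) I u"
    using geo by (auto simp: geodesic_on_def graph_map_lift)
  from geodesic_acceleration[OF this(2)] obtain u' \<mu> where
    u: "\<And>t. t \<in> I \<Longrightarrow> (u has_vector_derivative u' t) (at t within I)" and
    z: "\<And>t. t \<in> I \<Longrightarrow> ((\<lambda>t. f (u t)) has_vector_derivative grad (u t) \<bullet> u' t) (at t within I)" and
    u': "\<And>t. t \<in> I \<Longrightarrow> (u' has_vector_derivative \<mu> t *\<^sub>R grad (u t)) (at t within I)" and
    z': "\<And>t. t \<in> I \<Longrightarrow> ((\<lambda>t. grad (u t) \<bullet> u' t) has_vector_derivative \<mu> t) (at t within I)" and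
    \<mu>: "\<And>t. 0 \<le> \<mu> t"
    by blast
  define z' where "z' t = grad (u t) \<bullet> u' t" for t
  note z = z[folded z'_def] and z' = z'[folded z'_def]
  have lt: "\<bar>z' t\<bar> < norm (u' t)" if "u' t \<noteq> 0" for t
  proof -
    have "\<bar>z' t\<bar> \<le> norm (grad (u t)) * norm (u' t)"
      unfolding z'_def by (rule Cauchy_Schwarz_ineq2)
    also have "\<dots> < 1 * norm (u' t)"
      using that norm_grad by (intro mult_strict_right_mono) auto
    finally show ?thesis by simp
  qed
  have "((\<lambda>t. (norm (u' t))\<^sup>2 - (z' t)\<^sup>2) has_derivative (\<lambda>h. 0)) (at t within I)" if "t \<in> I" for t
  proof -
    have "((\<lambda>t. u' t \<bullet> u' t - z' t * z' t) has_vector_derivative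
        (u' t \<bullet> (\<mu> t *\<^sub>R grad (u t)) + (\<mu> t *\<^sub>R grad (u t)) \<bullet> u' t)
        - (z' t * \<mu> t + \<mu> t * z' t)) (at t within I)"
      using that by (intro has_vector_derivative_diff has_vector_derivative_mult
        bounded_bilinear.has_vector_derivative[OF bounded_bilinear_inner] u' z')
    moreover have "(u' t \<bullet> (\<mu> t *\<^sub>R grad (u t)) + (\<mu> t *\<^sub>R grad (u t)) \<bullet> u' t)
        - (z' t * \<mu> t + \<mu> t * z' t) = 0"
      by (simp add: z'_def inner_commute)
    ultimately show ?thesis
      by (simp add: has_vector_derivative_def power2_norm_eq_inner power2_eq_square[of "z' _"])
  qed
  from has_derivative_zero_constant[OF is_interval_convex[OF I] this]
  obtain \<kappa>0 where \<kappa>0: "\<forall>t\<in>I. (norm (u' t))\<^sup>2 - (z' t)\<^sup>2 = \<kappa>0" by auto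
  \<comment> \<open>On an empty \<open>I\<close> the constant \<open>\<kappa>0\<close> is arbitrary;
    the default 0 keeps \<open>\<kappa>\<close> nonnegative.\<close>
  define \<kappa> where "\<kappa> = (if I = {} then 0 else \<kappa>0)"
  have \<kappa>: "(norm (u' t))\<^sup>2 - (z' t)\<^sup>2 = \<kappa>" if "t \<in> I" for t
    using \<kappa>0 that by (auto simp: \<kappa>_def)
  have "0 \<le> \<kappa>"
  proof (cases "I = {}")
    case False
    then obtain t where "t \<in> I" by blast
    have "\<bar>z' t\<bar> \<le> norm (u' t)"
      using lt[of t] by (cases "u' t = 0") (auto simp: z'_def)
    then have "(z' t)\<^sup>2 \<le> (norm (u' t))\<^sup>2"
      by (metis abs_ge_zero power2_abs power_mono)
    then show ?thesis using \<kappa>[OF \<open>t \<in> I\<close>] by simp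
  qed (simp add: \<kappa>_def)
  have velocity: "velocity I \<gamma> t = lift (u' t) (z' t)" if "t \<in> I" for t
    unfolding velocity_def
  proof (rule vector_derivative_within[OF nontriv[OF that]])
    show "(\<gamma> has_vector_derivative lift (u' t) (z' t)) (at t within I)"
      using has_vector_derivative_lift[OF u[OF that] z[OF that]]
      by (rule has_vector_derivative_transform[rotated 2]) (use \<gamma> that in simp_all)
  qed
  have mono: "z' s \<le> z' t" if "s \<in> I" "t \<in> I" "s \<le> t" for s t
    using nonneg_vector_derivative_imp_mono[OF I z' \<mu> that] by simp
  have anti: "u' t \<bullet> e - z' t \<le> u' s \<bullet> e - z' s"
    if e: "norm e = 1" and st: "s \<in> I" "t \<in> I" "s \<le> t" for e s t
  proof -
    have deriv: "((\<lambda>t. z' t - u' t \<bullet> e) has_vector_derivative \<mu> t - (\<mu> t *\<^sub>R grad (u t)) \<bullet> e) (at t within I)"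
      if "t \<in> I" for t
      using that by (intro has_vector_derivative_diff z'
        bounded_linear.has_vector_derivative[OF bounded_linear_inner_left] u')
    have nonneg: "0 \<le> \<mu> t - (\<mu> t *\<^sub>R grad (u t)) \<bullet> e" for t
    proof -
      have "grad (u t) \<bullet> e \<le> 1"
        using norm_cauchy_schwarz[of "grad (u t)" e] norm_grad[of "u t"] e by simp
      then show ?thesis
        using \<mu>[of t] mult_left_mono[of "grad (u t) \<bullet> e" 1 "\<mu> t"] by simp
    qed
    from nonneg_vector_derivative_imp_mono[OF I deriv nonneg st] show ?thesis by simp
  qed
  show thesis
    by (rule that[OF \<open>0 \<le> \<kappa>\<close> \<gamma> velocity u z \<kappa> lt mono anti])
qed

end

section \<open>Asymptotics of a proper geodesic of finite length\<close>

theorem propositionE: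
  fixes f :: "real^2 \<Rightarrow> real" and \<Sigma> :: "(real^3) set" and \<phi> :: "real \<Rightarrow> ereal"
    and T :: ereal and I :: "real set" and \<gamma> :: "real \<Rightarrow> real^3"
  assumes "convex_entire_spacelike f"
    and "\<Sigma> = surface f"
    and "\<phi> = null_support \<Sigma>"
    and "0 < T" and "I = halfopen T"
    and "geodesic_on f I \<gamma>"
    and "proper_map (top_of_set I) (top_of_set \<Sigma>) \<gamma>"
    and "curve_length I \<gamma> < \<infinity>"
  shows "\<exists>\<theta>\<^sub>p\<in>circle.
      (\<forall>\<theta>\<in>circle.
        converges_projectively (velocity I \<gamma>) (null_vec \<theta>) (to_end T) \<longleftrightarrow> \<theta> = \<theta>\<^sub>p) \<and>
      (\<exists>!L. (\<exists>x. L = {x + r *\<^sub>R null_vec \<theta>\<^sub>p |r. True}) \<and> asymptotic_to \<gamma> L (to_end T)) \<and>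
      ((\<lambda>t. ereal (lorentz (\<gamma> t) (null_vec \<theta>\<^sub>p))) \<longlongrightarrow> \<phi> \<theta>\<^sub>p) (to_end T) \<and> \<phi> \<theta>\<^sub>p < \<infinity> \<and>
      (\<forall>\<theta>\<in>circle. \<theta> \<noteq> \<theta>\<^sub>p \<longrightarrow>
        filterlim (\<lambda>t. lorentz (\<gamma> t) (null_vec \<theta>)) at_bot (to_end T))"
proof -
  obtain f' f'' where df: "\<And>x. (f has_derivative blinfun_apply (f' x)) (at x)"
    and d2f: "\<And>x. (f' has_derivative blinfun_apply (f'' x)) (at x)"
    using assms(1) unfolding convex_entire_spacelike_def C2_def by blast
  interpret spacelike_graph f f' f''
  proof
    show "onorm (blinfun_apply (f' x)) < 1" for x
      using assms(1) unfolding convex_entire_spacelike_def frechet_derivative_at[OF df] by blast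
  qed (use assms(1) df d2f in \<open>auto simp: convex_entire_spacelike_def\<close>)
  have I: "is_interval I" and nontriv: "\<And>t. t \<in> I \<Longrightarrow> at t within I \<noteq> bot"
    using is_interval_halfopen at_within_halfopen_neq_bot by (auto simp: \<open>I = halfopen T\<close>)
  show ?thesis
  proof (rule geodesic_velocity[OF assms(6) I nontriv])
    fix \<kappa> u u' z' assume "0 \<le> \<kappa>"
      and \<gamma>: "\<And>t. t \<in> I \<Longrightarrow> \<gamma> t = lift (u t) (f (u t))"
      and velocity: "\<And>t. t \<in> I \<Longrightarrow> velocity I \<gamma> t = lift (u' t) (z' t)"
      and u: "\<And>t. t \<in> I \<Longrightarrow> (u has_vector_derivative u' t) (at t within I)"
      and z: "\<And>t. t \<in> I \<Longrightarrow> ((\<lambda>t. f (u t)) has_vector_derivative z' t) (at t within I)"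
      and speed: "\<And>t. t \<in> I \<Longrightarrow> (norm (u' t))\<^sup>2 - (z' t)\<^sup>2 = \<kappa>"
      and lt: "\<And>t. u' t \<noteq> 0 \<Longrightarrow> \<bar>z' t\<bar> < norm (u' t)"
      and mono: "\<And>s t. s \<in> I \<Longrightarrow> t \<in> I \<Longrightarrow> s \<le> t \<Longrightarrow> z' s \<le> z' t"
      and anti: "\<And>e s t. norm e = 1 \<Longrightarrow> s \<in> I \<Longrightarrow> t \<in> I \<Longrightarrow> s \<le> t \<Longrightarrow>
        u' t \<bullet> e - z' t \<le> u' s \<bullet> e - z' s"
    have \<Sigma>: "lift x (f x) \<in> \<Sigma>" for x
      by (auto simp: \<open>\<Sigma> = surface f\<close> surface_def graph_map_lift)
    \<comment> \<open>In infinite time, finite length forces speed zero. The geodesic is then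
      constant, and the preimage of its single point is the noncompact half-line.\<close>
    have "T \<noteq> \<infinity>"
    proof
      assume "T = \<infinity>"
      then have I_eq: "I = {0..}" by (simp add: \<open>I = halfopen T\<close> halfopen_infinity)
      have "curve_length I \<gamma> = (\<integral>\<^sup>+t. ennreal (sqrt \<kappa>) * indicator I t \<partial>lborel)"
        unfolding curve_length_def
        by (intro nn_integral_cong)
          (simp add: velocity lorentz_lift speed indicator_def flip: power2_norm_eq_inner power2_eq_square)
      also have "\<dots> = ennreal (sqrt \<kappa>) * \<infinity>"
        using emeasure_lborel_Ici[of 0] by (simp add: nn_integral_cmult_indicator I_eq)
      finally have "\<kappa> = 0"
        using assms(8) \<open>0 \<le> \<kappa>\<close> by (auto simp: ennreal_mult_top split: if_splits)
      \<comment> \<open>A nonzero tangent vector of a spacelike surface has positive Lorentzian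
        square.\<close>
      have u'0: "u' t = 0" if "t \<in> I" for t
      proof (rule ccontr)
        assume "u' t \<noteq> 0"
        have "\<bar>z' t\<bar>\<^sup>2 < (norm (u' t))\<^sup>2"
          using lt[OF \<open>u' t \<noteq> 0\<close>] by (intro power_strict_mono) auto
        then show False using speed[OF that] \<open>\<kappa> = 0\<close> by simp
      qed
      have "\<exists>p. \<forall>t\<in>I. u t = p"
      proof (rule has_derivative_zero_constant)
        show "convex I" using I by (rule is_interval_convex)
        show "(u has_derivative (\<lambda>h. 0)) (at t within I)" if "t \<in> I" for t
          using u[OF that] by (simp add: has_vector_derivative_def u'0[OF that])
      qed
      then obtain p where "\<And>t. t \<in> I \<Longrightarrow> \<gamma> t = lift p (f p)"
        using \<gamma> by metis
      then have "{t \<in> topspace (top_of_set I). \<gamma> t \<in> {lift p (f p)}} = I" by auto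
      then have "compactin (top_of_set I) I"
        using compactin_proper_map_preimage[OF assms(7), of "{lift p (f p)}"] \<Sigma>
        by (simp add: compactin_subtopology)
      then have "bounded {0::real..}"
        using I_eq by (simp add: compactin_subtopology compact_imp_bounded)
      then obtain B where "\<forall>t\<in>{0..}. norm (t::real) \<le> B"
        by (auto simp: bounded_iff)
      from bspec[OF this, of "\<bar>B\<bar> + 1"] show False by simp
    qed
    then obtain b where T: "T = ereal b" and "0 < b"
      using \<open>0 < T\<close> by (cases T) auto
    have I_eq: "I = {0..<b}" by (simp add: \<open>I = halfopen T\<close> T halfopen_ereal)
    let ?F = "at_left b"
    have ev_I: "\<forall>\<^sub>F t in ?F. t \<in> I"
      using eventually_at_left_real[OF \<open>0 < b\<close>] by (rule eventually_mono) (simp add: I_eq)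
    \<comment> \<open>Convergence of \<open>u\<close> alone is contradictory: the graph over
      \<open>cball p 1\<close> is a compact part of \<open>\<Sigma>\<close> in which the curve would
      remain.\<close>
    have divergent: False if p: "(u \<longlongrightarrow> p) ?F" for p
    proof (rule proper_map_no_limit)
      show "proper_map (top_of_set {0..<b}) (top_of_set \<Sigma>) \<gamma>"
        using assms(7) by (simp add: I_eq)
      have "continuous_on S f" for S
        using df by (meson continuous_at_imp_continuous_on has_derivative_continuous)
      then have "continuous_on (cball p 1) (\<lambda>x. lift x (f x))"
        unfolding lift_eq by (intro continuous_intros)
      then show "compact ((\<lambda>x. lift x (f x)) ` cball p 1)"
        by (rule compact_continuous_image) simp
      show "(\<lambda>x. lift x (f x)) ` cball p 1 \<subseteq> \<Sigma>"
        using \<Sigma> by blast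
      show "\<forall>\<^sub>F t in ?F. \<gamma> t \<in> (\<lambda>x. lift x (f x)) ` cball p 1"
        using tendstoD[OF p zero_less_one] ev_I
        by eventually_elim (auto simp: \<gamma> dist_commute intro!: image_eqI)
    qed fact
    obtain e y where e: "norm e = 1"
      and top: "filterlim (\<lambda>t. f (u t)) at_top ?F" and top': "filterlim z' at_top ?F"
      and y: "((\<lambda>t. u t - f (u t) *\<^sub>R e) \<longlongrightarrow> y) ?F"
      and direction: "((\<lambda>t. u' t /\<^sub>R z' t) \<longlongrightarrow> e) ?F"
    proof (rule causal_velocity_limit[OF \<open>0 < b\<close> \<open>0 \<le> \<kappa>\<close>])
      fix t assume "t \<in> {0..<b}"
      then show "(u has_vector_derivative u' t) (at t within {0..<b})"
        "((\<lambda>t. f (u t)) has_vector_derivative z' t) (at t within {0..<b})"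
        "(norm (u' t))\<^sup>2 - (z' t)\<^sup>2 = \<kappa>"
        using u[of t] z[of t] speed[of t] by (simp_all add: I_eq)
    qed (use mono anti divergent in \<open>auto simp: I_eq\<close>)
    obtain \<theta>\<^sub>p where \<theta>\<^sub>p: "\<theta>\<^sub>p \<in> circle" and dir: "dir \<theta>\<^sub>p = e"
      using dir_surj[OF e] by blast
    have null: "null_vec \<theta>\<^sub>p = lift e 1" by (simp add: null_vec_lift dir)

    have "converges_projectively (velocity I \<gamma>) (null_vec \<theta>\<^sub>p) ?F"
    proof (rule converges_projectivelyI[OF _ null_vec_nonzero])
      show ev: "\<forall>\<^sub>F t in ?F. z' t \<noteq> 0"
        using filterlim_at_top_dense[THEN iffD1, OF top', rule_format, of 0]
        by (rule eventually_mono) simp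
      \<comment> \<open>Division by \<open>z' t\<close> normalizes the third coordinate of the
        velocity to 1, as in \<open>null_vec\<close>.\<close>
      have "\<forall>\<^sub>F t in ?F. lift (u' t /\<^sub>R z' t) 1 = velocity I \<gamma> t /\<^sub>R z' t"
        using ev ev_I by eventually_elim (simp add: velocity lift_def vec_eq_iff forall_3)
      then show "((\<lambda>t. velocity I \<gamma> t /\<^sub>R z' t) \<longlongrightarrow> null_vec \<theta>\<^sub>p) ?F"
        unfolding null by (rule Lim_transform_eventually[OF tendsto_lift[OF direction tendsto_const]])
    qed
    then have 1: "\<forall>\<theta>\<in>circle.
        converges_projectively (velocity I \<gamma>) (null_vec \<theta>) ?F \<longleftrightarrow> \<theta> = \<theta>\<^sub>p"
      using converges_projectively_null_vec_iff \<theta>\<^sub>p by simp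

    have "((\<lambda>t. \<gamma> t - f (u t) *\<^sub>R null_vec \<theta>\<^sub>p) \<longlongrightarrow> lift y 0) ?F"
    proof (rule Lim_transform_eventually[OF tendsto_lift[OF y tendsto_const]])
      show "\<forall>\<^sub>F t in ?F. lift (u t - f (u t) *\<^sub>R e) 0 = \<gamma> t - f (u t) *\<^sub>R null_vec \<theta>\<^sub>p"
        using ev_I by eventually_elim (simp add: \<gamma> null lift_diff_scaleR)
    qed
    then have asym: "asymptotic_to \<gamma> {lift y 0 + r *\<^sub>R null_vec \<theta>\<^sub>p |r. True} ?F"
      by (rule asymptotic_to_lineI)
    have 2: "\<exists>!L. (\<exists>x. L = {x + r *\<^sub>R null_vec \<theta>\<^sub>p |r. True}) \<and> asymptotic_to \<gamma> L ?F"
    proof (rule ex1I, rule conjI)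
      show "\<exists>x. {lift y 0 + r *\<^sub>R null_vec \<theta>\<^sub>p |r. True} = {x + r *\<^sub>R null_vec \<theta>\<^sub>p |r. True}"
        by (rule exI, rule refl)
      show "asymptotic_to \<gamma> {lift y 0 + r *\<^sub>R null_vec \<theta>\<^sub>p |r. True} ?F" by fact
      fix L
      assume "(\<exists>x. L = {x + r *\<^sub>R null_vec \<theta>\<^sub>p |r. True}) \<and> asymptotic_to \<gamma> L ?F"
      then obtain x where L: "L = {x + r *\<^sub>R null_vec \<theta>\<^sub>p |r. True}" and "asymptotic_to \<gamma> L ?F"
        by blast
      from asymptotic_to_line_unique[OF this(2)[unfolded L] asym]
      show "L = {lift y 0 + r *\<^sub>R null_vec \<theta>\<^sub>p |r. True}"
        unfolding L by simp
    qed

    \<comment> \<open>This splits the product into a convergent term and a multiple of the diverging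
      height. The coefficient \<open>e \<bullet> dir \<theta> - 1\<close> vanishes at
      \<open>\<theta>\<^sub>p\<close> and is negative at other angles, which decides the last two
      claims.\<close>
    have product: "\<forall>\<^sub>F t in ?F. (u t - f (u t) *\<^sub>R e) \<bullet> dir \<theta> + (e \<bullet> dir \<theta> - 1) * f (u t)
        = lorentz (\<gamma> t) (null_vec \<theta>)" for \<theta>
      using ev_I by eventually_elim (simp add: \<gamma> null_vec_lift lorentz_lift algebra_simps)
    have "((\<lambda>t. lorentz (\<gamma> t) (null_vec \<theta>\<^sub>p)) \<longlongrightarrow> y \<bullet> e) ?F"
    proof (rule Lim_transform_eventually[OF _ product])
      show "((\<lambda>t. (u t - f (u t) *\<^sub>R e) \<bullet> dir \<theta>\<^sub>p + (e \<bullet> dir \<theta>\<^sub>p - 1) * f (u t)) \<longlongrightarrow> y \<bullet> e) ?F"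
        using tendsto_inner[OF y tendsto_const[of e]] e by (simp add: dir norm_eq_1)
    qed
    then have lim: "((\<lambda>t. ereal (lorentz (\<gamma> t) (null_vec \<theta>\<^sub>p))) \<longlongrightarrow> ereal (y \<bullet> e)) ?F"
      by simp
    \<comment> \<open>The Lipschitz bound gives the upper estimate; the points of the curve itself,
      being on \<open>\<Sigma>\<close>, give the lower one.\<close>
    have \<phi>: "\<phi> \<theta>\<^sub>p = ereal (y \<bullet> e)"
    proof (rule antisym)
      show "\<phi> \<theta>\<^sub>p \<le> ereal (y \<bullet> e)"
        unfolding \<open>\<phi> = null_support \<Sigma>\<close> null_support_def
      proof (rule SUP_least)
        fix p assume "p \<in> \<Sigma>"
        then obtain v where "p = lift v (f v)"
          by (auto simp: \<open>\<Sigma> = surface f\<close> surface_def graph_map_lift)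
        then show "ereal (lorentz p (null_vec \<theta>\<^sub>p)) \<le> ereal (y \<bullet> e)"
          using lipschitz_graph_null_bound[OF _ e lipschitz _ top y, of v] by (simp add: null lorentz_lift)
      qed
      have "\<forall>\<^sub>F t in ?F. ereal (lorentz (\<gamma> t) (null_vec \<theta>\<^sub>p)) \<le> \<phi> \<theta>\<^sub>p"
        using ev_I unfolding \<open>\<phi> = null_support \<Sigma>\<close> null_support_def
        by eventually_elim (auto intro!: SUP_upper simp: \<gamma> \<Sigma>)
      then show "ereal (y \<bullet> e) \<le> \<phi> \<theta>\<^sub>p"
        by (intro tendsto_upperbound[OF lim]) simp_all
    qed
    have 4: "filterlim (\<lambda>t. lorentz (\<gamma> t) (null_vec \<theta>)) at_bot ?F"
      if "\<theta> \<in> circle" "\<theta> \<noteq> \<theta>\<^sub>p" for \<theta>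
    proof -
      have "dir \<theta> \<noteq> e"
        using dir_inject[OF that(1) \<theta>\<^sub>p] that(2) dir by auto
      \<comment> \<open>For unit vectors this square equals
        \<open>2 - 2 * (e \<bullet> dir \<theta>)\<close>.\<close>
      then have "0 < (e - dir \<theta>) \<bullet> (e - dir \<theta>)" by simp
      then have "e \<bullet> dir \<theta> - 1 < 0"
        using e norm_dir[of \<theta>] by (simp add: norm_eq_1 inner_diff inner_commute)
      then have "filterlim (\<lambda>t. (e \<bullet> dir \<theta> - 1) * f (u t)) at_bot ?F"
        by (rule filterlim_tendsto_neg_mult_at_bot[OF tendsto_const _ top])
      then have "filterlim (\<lambda>t. (u t - f (u t) *\<^sub>R e) \<bullet> dir \<theta> + (e \<bullet> dir \<theta> - 1) * f (u t)) at_bot ?F"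
        by (simp add: filterlim_tendsto_add_at_bot_iff[OF tendsto_inner[OF y tendsto_const]])
      then show ?thesis
        using filterlim_cong[OF refl refl product] by simp
    qed
    show ?thesis
      unfolding T to_end_ereal using \<theta>\<^sub>p 1 2 lim 4 by (intro bexI[of _ \<theta>\<^sub>p]) (auto simp: \<phi>)
  qed
qed

end
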